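(* Let $H$ be an infinite-dimensional separable complex Hilbert space. For every $T\in\mathcal{B}(H)$, if $|T|\in\beta(H)$, then $T\in\beta(H)$. The converse implication fails in general: there exists $T\in\mathcal{B}(H)$ with $T\in\beta(H)$ but $|T|\notin\beta(H)$.
   Context: $\mathcal{B}(H)$ is the algebra of bounded linear operators on $H$, and $|T|:=(T^*T)^{1/2}$. A closed subspace $M\subseteq H$ is reducing for $T\in\mathcal{B}(H)$ if $TM\subseteq M$ and $TM^\perp\subseteq M^\perp$; $\mathcal{R}_T$ denotes the collection of all reducing subspaces of $T$. For $M\in\mathcal{R}_T$ non-zero, the restriction $T|_M$ is norm attaining if there is a unit vector $x\in M$ with $\|Tx\|=\|T|_M\|$, where $\|T|_M\|=\sup\{\|Ty\|:y\in M,\|y\|=1\}$. The class $\beta(H)$ is $$\beta(H):=\{T\in\mathcal{B}(H): T|_M \text{ is norm attaining for every non-zero } M\in\mathcal{R}_T\}.$$ *)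

theory Defs
  imports "HOL-Analysis.Analysis"
begin

(* Complex inner product spaces, inner product linear in the first argument. The class sits on top
   of real_inner, so that norm and topology are those of the library; since the real inner product
   is the real part of the complex one, norm x = sqrt (Re (cinner x x)) and cinner is positive
   definite (see cinner_self and norm_eq_sqrt_cinner). *)
class complex_inner = real_inner +
  fixes scaleC :: "complex \<Rightarrow> 'a \<Rightarrow> 'a"  (infixr \<open>*\<^sub>C\<close> 75)
    and cinner :: "'a \<Rightarrow> 'a \<Rightarrow> complex"
  assumes scaleC_add_right: "c *\<^sub>C (x + y) = c *\<^sub>C x + c *\<^sub>C y"
    and scaleC_add_left: "(c + d) *\<^sub>C x = c *\<^sub>C x + d *\<^sub>C x"
    and scaleC_scaleC: "c *\<^sub>C (d *\<^sub>C x) = (c * d) *\<^sub>C x"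
    and scaleC_one: "1 *\<^sub>C x = x"
    and scaleC_of_real: "complex_of_real r *\<^sub>C x = r *\<^sub>R x"
    and cinner_commute: "cinner x y = cnj (cinner y x)"
    and cinner_add_left: "cinner (x + y) z = cinner x z + cinner y z"
    and cinner_scaleC_left: "cinner (c *\<^sub>C x) y = c * cinner x y"
    and Re_cinner: "Re (cinner x y) = inner x y"

class complex_hilbert_space = complex_inner + complete_space

global_interpretation complex_vector: vector_space "scaleC :: complex \<Rightarrow> 'a \<Rightarrow> 'a::complex_inner"
  by unfold_locales
    (simp_all add: scaleC_add_right scaleC_add_left scaleC_scaleC scaleC_one)

lemma cinner_self: "cinner x x = complex_of_real ((norm x)\<^sup>2)"
  for x :: "'a::complex_inner"
proof (rule complex_eqI)
  show "Re (cinner x x) = Re (complex_of_real ((norm x)\<^sup>2))"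
    by (simp add: Re_cinner power2_norm_eq_inner)
  show "Im (cinner x x) = Im (complex_of_real ((norm x)\<^sup>2))"
    using arg_cong[OF cinner_commute[of x x], of Im] by simp
qed

lemma norm_eq_sqrt_cinner: "norm x = sqrt (Re (cinner x x))"
  for x :: "'a::complex_inner"
  by (simp add: Re_cinner norm_eq_sqrt_inner)

definition infinite_dimensional :: "'a::complex_inner itself \<Rightarrow> bool" where
  "infinite_dimensional _ \<longleftrightarrow>
     \<not> (\<exists>B :: 'a set. finite B \<and> complex_vector.span B = UNIV)"

definition bounded_operators :: "('a::complex_inner \<Rightarrow> 'a) set" where
  "bounded_operators = {T. bounded_linear T \<and> (\<forall>c x. T (c *\<^sub>C x) = c *\<^sub>C T x)}"

(* For T in bounded_operators on a Hilbert space the adjoint exists (Riesz) and is unique. *)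
definition cadjoint :: "('a::complex_inner \<Rightarrow> 'a) \<Rightarrow> 'a \<Rightarrow> 'a" where
  "cadjoint T = (THE S. \<forall>x y. cinner (T x) y = cinner x (S y))"

definition positive_operator :: "('a::complex_inner \<Rightarrow> 'a) \<Rightarrow> bool" where
  "positive_operator S \<longleftrightarrow> S \<in> bounded_operators \<and> (\<forall>x. cinner (S x) x \<in> \<real>\<^sub>\<ge>\<^sub>0)"

(* The positive square root of a positive operator on a Hilbert space exists and is unique. *)
definition sqrt_operator :: "('a::complex_inner \<Rightarrow> 'a) \<Rightarrow> 'a \<Rightarrow> 'a" where
  "sqrt_operator A = (THE S. positive_operator S \<and> S \<circ> S = A)"

definition abs_operator :: "('a::complex_inner \<Rightarrow> 'a) \<Rightarrow> 'a \<Rightarrow> 'a" where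
  "abs_operator T = sqrt_operator (cadjoint T \<circ> T)"

definition orth_complement :: "'a::complex_inner set \<Rightarrow> 'a set" where
  "orth_complement M = {x. \<forall>y\<in>M. cinner x y = 0}"

definition reducing_subspaces :: "('a::complex_inner \<Rightarrow> 'a) \<Rightarrow> 'a set set" where
  "reducing_subspaces T = {M. complex_vector.subspace M \<and> closed M \<and>
     T ` M \<subseteq> M \<and> T ` orth_complement M \<subseteq> orth_complement M}"

definition restriction_norm :: "('a::complex_inner \<Rightarrow> 'a) \<Rightarrow> 'a set \<Rightarrow> real" where
  "restriction_norm T M = (SUP y\<in>{y \<in> M. norm y = 1}. norm (T y))"

definition norm_attaining_on :: "('a::complex_inner \<Rightarrow> 'a) \<Rightarrow> 'a set \<Rightarrow> bool" where
  "norm_attaining_on T M \<longleftrightarrow> (\<exists>x\<in>M. norm x = 1 \<and> norm (T x) = restriction_norm T M)"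

definition beta_class :: "('a::complex_inner \<Rightarrow> 'a) set" where
  "beta_class = {T \<in> bounded_operators.
     \<forall>M\<in>reducing_subspaces T. M \<noteq> {0} \<longrightarrow> norm_attaining_on T M}"

end

theory Submission
  imports Defs
begin

text \<open>
  For the implication, \<open>\<parallel>\<bar>T\<bar> x\<parallel> = \<parallel>T x\<parallel>\<close> for all \<open>x\<close>, so on any fixed subspace \<open>T\<close> attains its norm if and
  only if \<open>\<bar>T\<bar>\<close> does. It remains to see that a subspace \<open>M\<close> reducing \<open>T\<close> also reduces \<open>\<bar>T\<bar>\<close>
  (\<open>reducing_abs_operator\<close>): \<open>M\<close> is invariant under \<open>T\<^sup>* T\<close>, and the positive square root is a
  pointwise limit of polynomials in \<open>T\<^sup>* T\<close>. The square root comes from iterating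
  \<open>Y \<mapsto> (B + Y\<^sup>2) / 2\<close> with \<open>B = 1 - T\<^sup>* T\<close> (for \<open>\<parallel>T\<parallel> \<le> 1\<close>), which converges because it is majorised
  by the same iteration on real numbers with \<open>B = 1\<close>. As a limit of polynomials it commutes with
  every other positive square root of \<open>T\<^sup>* T\<close>, whence uniqueness (\<open>abs_operator_unique\<close>).

  The converse fails because \<open>\<bar>T\<bar>\<close> can have more reducing subspaces than \<open>T\<close>. Take an orthonormal
  sequence \<open>e 0, e 1, \<dots>\<close> and let \<open>D\<close> have the eigenvalue \<open>2\<close> at \<open>e 0\<close>, the eigenvalue
  \<open>1 - 2\<^sup>-\<^sup>n\<close> at \<open>e n\<close> for \<open>n \<ge> 1\<close>, and be the identity on the orthogonal complement of the sequence.
  On the closed span of \<open>e 1, e 2, \<dots>\<close> it does not attain its norm \<open>1\<close>. Now let \<open>U\<close> be the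
  reflection in a vector \<open>v\<close> that is orthogonal to no \<open>e n\<close>, and \<open>T = U D\<close>. As \<open>U\<close> is unitary and
  \<open>D\<close> is positive, \<open>\<bar>T\<bar> = D\<close>. A subspace reducing \<open>T\<close> reduces \<open>D\<close>, so each \<open>e n\<close> lies in it or in its
  complement, and the reflection ties all of them together through \<open>v\<close>: either \<open>e 0\<close> lies in the
  subspace and the norm \<open>2\<close> is attained there, or the subspace is orthogonal to \<open>v\<close> and every
  \<open>e n\<close>, and \<open>T\<close> is the identity on it.
\<close>

instance complex_hilbert_space \<subseteq> banach ..

section \<open>The complex inner product\<close>

lemma cinner_add_right: "cinner x (y + z) = cinner x y + cinner x z"
  by (metis cinner_add_left cinner_commute complex_cnj_add)

lemma cinner_scaleC_right: "cinner x (c *\<^sub>C y) = cnj c * cinner x y"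
  by (metis cinner_commute cinner_scaleC_left complex_cnj_mult)

lemma Im_cinner: "Im (cinner x y) = - inner (\<i> *\<^sub>C x) y"
  by (simp flip: Re_cinner add: cinner_scaleC_left)

lemma norm_scaleC: "norm (c *\<^sub>C x) = cmod c * norm x" for x :: "'a::complex_inner"
proof -
  have "complex_of_real ((norm (c *\<^sub>C x))\<^sup>2) = complex_of_real ((cmod c * norm x)\<^sup>2)"
    unfolding cinner_self[symmetric] cinner_scaleC_left cinner_scaleC_right power_mult_distrib
      of_real_mult complex_norm_square
    by (simp add: cinner_self mult.assoc)
  then show ?thesis
    by (simp only: of_real_eq_iff) (simp add: power2_eq_iff_nonneg)
qed

text \<open>Multiplying \<^term>\<open>x\<close> by a suitable phase makes the inner product real, so that the
  real Cauchy-Schwarz inequality applies.\<close>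

lemma norm_cinner_le: "cmod (cinner x y) \<le> norm x * norm y"
proof -
  define c where "c = cnj (sgn (cinner x y))"
  have "c * cinner x y = complex_of_real (cmod (cinner x y))"
    using complex_norm_square[of "cinner x y"]
    by (cases "cinner x y = 0") (simp_all add: c_def sgn_eq power2_eq_square field_simps)
  then have "cmod (cinner x y) = inner (c *\<^sub>C x) y"
    by (simp add: Re_cinner[symmetric] cinner_scaleC_left)
  also have "\<dots> \<le> norm (c *\<^sub>C x) * norm y"
    by (rule norm_cauchy_schwarz)
  also have "\<dots> \<le> norm x * norm y"
    by (intro mult_right_mono) (auto simp: norm_scaleC c_def norm_sgn)
  finally show ?thesis .
qed

lemma bounded_bilinear_cinner: "bounded_bilinear cinner"
proof
  show "cinner (r *\<^sub>R x) y = r *\<^sub>R cinner x y" "cinner x (r *\<^sub>R y) = r *\<^sub>R cinner x y"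
    for r and x y :: 'a
    by (simp_all flip: scaleC_of_real add: cinner_scaleC_left cinner_scaleC_right scaleR_conv_of_real)
  show "\<exists>K. \<forall>(x::'a) y. norm (cinner x y) \<le> norm x * norm y * K"
    by (rule exI[of _ 1]) (simp add: norm_cinner_le)
qed (simp_all add: cinner_add_left cinner_add_right)

interpretation cinner: bounded_bilinear cinner
  by (rule bounded_bilinear_cinner)

lemma bounded_bilinear_scaleC: "bounded_bilinear (scaleC :: complex \<Rightarrow> 'a \<Rightarrow> 'a::complex_inner)"
proof
  show "(r *\<^sub>R c) *\<^sub>C x = r *\<^sub>R (c *\<^sub>C x)" "c *\<^sub>C (r *\<^sub>R x) = r *\<^sub>R (c *\<^sub>C x)"
    for r c and x :: 'a
    by (simp_all flip: scaleC_of_real add: scaleC_scaleC scaleR_conv_of_real mult.commute)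
  show "\<exists>K. \<forall>c (x::'a). norm (c *\<^sub>C x) \<le> norm c * norm x * K"
    by (rule exI[of _ 1]) (simp add: norm_scaleC)
qed (simp_all add: scaleC_add_left scaleC_add_right)

interpretation scaleC: bounded_bilinear "scaleC :: complex \<Rightarrow> 'a \<Rightarrow> 'a::complex_inner"
  by (rule bounded_bilinear_scaleC)

lemma eq_if_cinner_eq: "(\<And>z. cinner z x = cinner z y) \<Longrightarrow> x = y"
proof -
  assume "\<And>z. cinner z x = cinner z y"
  then have "cinner (x - y) (x - y) = 0"
    by (simp add: cinner.diff_right)
  then show ?thesis
    by (simp add: cinner_self)
qed

lemma complex_subspace_scaleR:
  "complex_vector.subspace M \<Longrightarrow> x \<in> M \<Longrightarrow> r *\<^sub>R x \<in> M"
  by (metis complex_vector.subspace_scale scaleC_of_real)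

section \<open>Orthogonal decomposition and adjoints\<close>

text \<open>The vector is the minimiser of the quadratic functional \<open>\<parallel>y\<parallel>\<^sup>2 - 2 f y\<close> on the subspace: by the
  parallelogram law a minimising sequence is Cauchy, and the derivative of the functional vanishes
  at the minimum. With \<open>f = inner x\<close> this is the orthogonal projection of \<open>x\<close>, and on the whole
  space it is the Riesz representation of \<open>f\<close>.\<close>

lemma riesz_on_closed_subspace:
  fixes f :: "'a::{real_inner,complete_space} \<Rightarrow> real"
  assumes f: "bounded_linear f" and M: "subspace M" "closed M"
  obtains z where "z \<in> M" and "\<And>y. y \<in> M \<Longrightarrow> f y = inner y z"
proof -
  interpret f: bounded_linear f by (rule f)
  define g where "g y = (norm y)\<^sup>2 - 2 * f y" for y
  obtain K where K: "\<And>y. norm (f y) \<le> norm y * K"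
    using f.bounded by blast
  have "g y \<ge> - K\<^sup>2" for y
  proof -
    have "0 \<le> (norm y - K)\<^sup>2" by simp
    then show ?thesis
      using K[of y] by (simp add: g_def power2_diff)
  qed
  then have bdd: "bdd_below (g ` M)"
    by (auto intro!: bdd_belowI)
  define m where "m = Inf (g ` M)"
  have m_le: "m \<le> g y" if "y \<in> M" for y
    unfolding m_def using bdd that by (simp add: cINF_lower)
  have "\<exists>y\<in>M. g y < m + 1 / real (Suc n)" for n
    using cInf_lessD[of "g ` M" "m + 1 / real (Suc n)"] subspace_0[OF M(1)]
    by (auto simp: m_def)
  then obtain s where sM: "s n \<in> M" and s: "g (s n) < m + 1 / real (Suc n)" for n
    by metis
  have dist_s: "(dist (s i) (s j))\<^sup>2 < 2 / real (Suc i) + 2 / real (Suc j)" for i j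
  proof -
    define h where "h = (1/2) *\<^sub>R (s i + s j)"
    have "h \<in> M"
      unfolding h_def using M sM by (intro subspace_mul subspace_add)
    have "(dist (s i) (s j))\<^sup>2 = 2 * g (s i) + 2 * g (s j) - 4 * g h"
      unfolding dist_norm g_def h_def power2_norm_eq_inner
      by (simp add: f.add f.scaleR algebra_simps inner_commute)
    then show ?thesis
      using s[of i] s[of j] m_le[OF \<open>h \<in> M\<close>] by simp
  qed
  have "Cauchy s"
  proof (rule metric_CauchyI)
    fix e :: real assume "e > 0"
    then obtain N where N: "1 / real (Suc N) < e\<^sup>2 / 4"
      by (metis nat_approx_posE zero_less_divide_iff zero_less_numeral zero_less_power)
    have "dist (s i) (s j) < e" if "i \<ge> N" "j \<ge> N" for i j
    proof -
      have "1 / real (Suc i) \<le> 1 / real (Suc N)" "1 / real (Suc j) \<le> 1 / real (Suc N)"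
        using that by (auto intro!: divide_left_mono)
      then have "(dist (s i) (s j))\<^sup>2 < e\<^sup>2"
        using dist_s[of i j] N by simp
      then show ?thesis
        using \<open>e > 0\<close> by (simp add: power_less_imp_less_base)
    qed
    then show "\<exists>N. \<forall>i\<ge>N. \<forall>j\<ge>N. dist (s i) (s j) < e" by blast
  qed
  then obtain z where z: "s \<longlonglongrightarrow> z"
    using Cauchy_convergent convergent_def by blast
  have "z \<in> M"
    using closed_sequentially[OF M(2)] sM z by blast
  have "(\<lambda>n. g (s n)) \<longlonglongrightarrow> g z"
    unfolding g_def by (intro tendsto_intros z f.tendsto)
  moreover have "(\<lambda>n. m + 1 / real (Suc n)) \<longlonglongrightarrow> m"
    using tendsto_add[OF tendsto_const LIMSEQ_inverse_real_of_nat, of m]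
    by (simp add: inverse_eq_divide)
  ultimately have "g z \<le> m"
    by (rule LIMSEQ_le) (use s less_imp_le in blast)
  have "f y = inner y z" if "y \<in> M" for y
  proof -
    define d where "d = inner y z - f y"
    have quad: "0 \<le> 2 * t * d + t\<^sup>2 * (norm y)\<^sup>2" for t
    proof -
      have "z + t *\<^sub>R y \<in> M"
        using M \<open>z \<in> M\<close> that by (intro subspace_mul subspace_add)
      then have "g z \<le> g (z + t *\<^sub>R y)"
        using m_le \<open>g z \<le> m\<close> order_trans by blast
      then show ?thesis
        unfolding g_def d_def power2_norm_eq_inner
        by (simp add: f.add f.scaleR algebra_simps inner_commute power2_eq_square)
    qed
    \<comment> \<open>The value \<open>t = - d / \<parallel>y\<parallel>\<^sup>2\<close> minimises the right-hand side; the added \<open>1\<close> avoids division by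
      zero and still yields a negative value unless \<open>d = 0\<close>.\<close>
    define q where "q = (norm y)\<^sup>2 + 1"
    have "q > 0"
      by (simp add: q_def add_nonneg_pos)
    have "0 \<le> 2 * (- d / q) * d + (- d / q)\<^sup>2 * (norm y)\<^sup>2"
      by (rule quad)
    also have "\<dots> \<le> 2 * (- d / q) * d + (- d / q)\<^sup>2 * q"
      by (intro add_left_mono mult_left_mono) (auto simp: q_def)
    also have "\<dots> = - (d\<^sup>2 / q)"
      using \<open>q > 0\<close> by (simp add: power2_eq_square field_simps)
    finally have "d\<^sup>2 \<le> 0"
      using \<open>q > 0\<close> by (simp add: divide_le_0_iff)
    then show ?thesis
      by (simp add: d_def)
  qed
  then show ?thesis
    using that \<open>z \<in> M\<close> by blast
qed

lemma orthogonal_decomposition: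
  fixes M :: "'a::complex_hilbert_space set"
  assumes M: "complex_vector.subspace M" "closed M"
  obtains p q where "p \<in> M" "q \<in> orth_complement M" "x = p + q"
proof -
  have "subspace M"
    using M(1) by (simp add: subspace_def complex_subspace_scaleR complex_vector.subspace_0
        complex_vector.subspace_add)
  then obtain p where p: "p \<in> M" and ip: "\<And>y. y \<in> M \<Longrightarrow> inner x y = inner y p"
    using riesz_on_closed_subspace[OF bounded_linear_inner_right _ M(2), of x] by blast
  have "cinner (x - p) y = 0" if "y \<in> M" for y
  proof (rule complex_eqI)
    have "\<i> *\<^sub>C y \<in> M"
      using M(1) that by (rule complex_vector.subspace_scale)
    have *: "inner (x - p) w = 0" if "w \<in> M" for w
      using ip[OF that] by (simp add: inner_diff_left inner_commute[of w])
    show "Re (cinner (x - p) y) = Re 0"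
      using *[OF that] by (simp add: Re_cinner)
    have "Im (cinner (x - p) y) = Re (cinner (x - p) (\<i> *\<^sub>C y))"
      by (simp add: cinner_scaleC_right)
    then show "Im (cinner (x - p) y) = Im 0"
      using *[OF \<open>\<i> *\<^sub>C y \<in> M\<close>] by (simp add: Re_cinner)
  qed
  then have "x - p \<in> orth_complement M"
    by (simp add: orth_complement_def)
  then show ?thesis
    using that[OF p, of "x - p"] by simp
qed

lemma orth_complementD:
  assumes "x \<in> orth_complement M" "y \<in> M"
  shows "cinner x y = 0" "cinner y x = 0"
  using assms cinner_commute[of y x] by (auto simp: orth_complement_def)

lemma in_both_orth_complement: "x \<in> M \<Longrightarrow> x \<in> orth_complement M \<Longrightarrow> x = 0"
  using cinner_self[of x] by (auto simp: orth_complement_def)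

lemma subspace_orth_complement: "complex_vector.subspace (orth_complement M)"
  by (auto simp: complex_vector.subspace_def orth_complement_def cinner_add_left cinner_scaleC_left
      cinner.zero_left)

lemma closed_orth_complement: "closed (orth_complement M)"
proof -
  have "orth_complement M = (\<Inter>y\<in>M. {x. cinner x y = 0})"
    by (auto simp: orth_complement_def)
  then show ?thesis
    by (auto intro!: closed_INT closed_Collect_eq cinner.continuous_on continuous_intros)
qed

text \<open>A vector orthogonal to the complement of a closed subspace belongs to the subspace: its
  component in the complement is orthogonal to itself.\<close>

lemma double_orth_complement:
  fixes M :: "'a::complex_hilbert_space set"
  assumes M: "complex_vector.subspace M" "closed M"
  shows "orth_complement (orth_complement M) = M"
proof
  show "M \<subseteq> orth_complement (orth_complement M)"
    unfolding orth_complement_def[of "orth_complement M"] by (blast intro: orth_complementD(2))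
  show "orth_complement (orth_complement M) \<subseteq> M"
  proof
    fix x assume x: "x \<in> orth_complement (orth_complement M)"
    obtain p q where pq: "p \<in> M" "q \<in> orth_complement M" "x = p + q"
      using orthogonal_decomposition[OF M] .
    have "cinner q q = 0"
      using orth_complementD(1)[OF x pq(2)] orth_complementD(2)[OF pq(2,1)] pq(3)
      by (simp add: cinner_add_left)
    then show "x \<in> M"
      using pq by (simp add: cinner_self)
  qed
qed

definition is_adjoint :: "('a::complex_inner \<Rightarrow> 'a) \<Rightarrow> ('a \<Rightarrow> 'a) \<Rightarrow> bool" where
  "is_adjoint T S \<longleftrightarrow> (\<forall>x y. cinner (T x) y = cinner x (S y))"

lemma is_adjointD: "is_adjoint T S \<Longrightarrow> cinner (T x) y = cinner x (S y)"
  by (simp add: is_adjoint_def)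

lemma is_adjoint_sym: "is_adjoint T S \<Longrightarrow> is_adjoint S T"
  unfolding is_adjoint_def by (metis cinner_commute)

lemma cadjoint_eqI: "is_adjoint T S \<Longrightarrow> cadjoint T = S"
  unfolding cadjoint_def is_adjoint_def
  by (rule the_equality, assumption) (rule ext, rule eq_if_cinner_eq, simp)

lemma bounded_operatorD:
  assumes "T \<in> bounded_operators"
  shows "bounded_linear T" "T (c *\<^sub>C x) = c *\<^sub>C T x"
  using assms by (auto simp: bounded_operators_def)

lemma bounded_operators_comp:
  "S \<in> bounded_operators \<Longrightarrow> T \<in> bounded_operators \<Longrightarrow> S \<circ> T \<in> bounded_operators"
  by (auto simp: bounded_operators_def bounded_linear_compose comp_def)

lemma bounded_operators_diff:
  "S \<in> bounded_operators \<Longrightarrow> T \<in> bounded_operators \<Longrightarrow> (\<lambda>x. S x - T x) \<in> bounded_operators"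
  by (auto simp: bounded_operators_def bounded_linear_sub scaleC.diff_right)

lemma bounded_operators_scaleR:
  "T \<in> bounded_operators \<Longrightarrow> (\<lambda>x. r *\<^sub>R T x) \<in> bounded_operators"
  by (auto simp: bounded_operators_def bounded_linear_const_scaleR scaleC.scaleR_right)

lemma bounded_operators_ident: "(\<lambda>x. x) \<in> bounded_operators"
  by (auto simp: bounded_operators_def bounded_linear_ident)

text \<open>The Riesz vector of \<open>x \<mapsto> Re \<langle>T x, y\<rangle>\<close> is the value of the adjoint at \<open>y\<close>; the imaginary parts agree
  as well because \<open>T\<close> commutes with multiplication by \<open>\<i>\<close>.\<close>

lemma adjoint_exists:
  fixes T :: "'a::complex_hilbert_space \<Rightarrow> 'a"
  assumes T: "T \<in> bounded_operators"
  obtains S where "is_adjoint T S"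
proof -
  have "\<exists>z. \<forall>x. cinner (T x) y = cinner x z" for y
  proof -
    have "bounded_linear (\<lambda>x. inner (T x) y)"
      using bounded_linear_compose[OF bounded_linear_inner_left bounded_operatorD(1)[OF T]] .
    then obtain z where z: "\<And>x. inner (T x) y = inner x z"
      using riesz_on_closed_subspace[of "\<lambda>x. inner (T x) y" UNIV] by auto
    have "cinner (T x) y = cinner x z" for x
      by (rule complex_eqI)
        (simp_all add: Re_cinner Im_cinner z flip: bounded_operatorD(2)[OF T])
    then show ?thesis by blast
  qed
  then obtain S where "\<And>x y. cinner (T x) y = cinner x (S y)"
    by metis
  then show ?thesis
    using that[of S] by (simp add: is_adjoint_def)
qed

lemma is_adjoint_norm_le:
  assumes "is_adjoint T S" and T: "\<And>x. norm (T x) \<le> K * norm x"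
  shows "norm (S y) \<le> K * norm y"
proof (cases "S y = 0")
  case True
  have "0 \<le> K * norm y"
    using T[of y] norm_ge_zero order_trans by blast
  then show ?thesis
    using True by simp
next
  case False
  have "(norm (S y))\<^sup>2 = Re (cinner (T (S y)) y)"
    using is_adjointD[OF assms(1), of "S y" y] cinner_self[of "S y"] by simp
  also have "\<dots> \<le> norm (T (S y)) * norm y"
    using norm_cinner_le complex_Re_le_cmod order_trans by blast
  also have "\<dots> \<le> (K * norm (S y)) * norm y"
    using T by (simp add: mult_right_mono)
  finally show ?thesis
    using False by (simp add: power2_eq_square mult.assoc mult.commute mult.left_commute)
qed

lemma is_adjoint_bounded_operators:
  assumes TS: "is_adjoint T S" and T: "T \<in> bounded_operators"
  shows "S \<in> bounded_operators"
proof -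
  obtain K where K: "\<And>x. norm (T x) \<le> norm x * K"
    using bounded_linear.bounded[OF bounded_operatorD(1)[OF T]] by blast
  have S: "cinner z (S y) = cinner (T z) y" for z y
    using is_adjointD[OF TS] by simp
  have scaleC: "S (c *\<^sub>C x) = c *\<^sub>C S x" for c x
    by (rule eq_if_cinner_eq) (simp add: S cinner_scaleC_right)
  have "bounded_linear S"
  proof (rule bounded_linear_intro)
    show "S (x + y) = S x + S y" for x y
      by (rule eq_if_cinner_eq) (simp add: S cinner_add_right)
    show "S (r *\<^sub>R x) = r *\<^sub>R S x" for r x
      using scaleC[of "of_real r" x] by (simp add: scaleC_of_real)
    show "norm (S x) \<le> norm x * K" for x
      using is_adjoint_norm_le[OF TS, of K x] K by (simp add: mult.commute)
  qed
  then show ?thesis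
    using scaleC by (simp add: bounded_operators_def)
qed

lemma is_adjoint_orth_complement:
  assumes "is_adjoint T S" "T ` M \<subseteq> M"
  shows "S ` orth_complement M \<subseteq> orth_complement M"
proof (rule image_subsetI)
  fix x assume x: "x \<in> orth_complement M"
  have "cinner (S x) y = 0" if "y \<in> M" for y
  proof -
    have "T y \<in> M"
      using assms(2) that by blast
    then have "cinner x (T y) = 0"
      by (rule orth_complementD(1)[OF x])
    then show ?thesis
      using is_adjointD[OF is_adjoint_sym[OF assms(1)]] by simp
  qed
  then show "S x \<in> orth_complement M"
    by (simp add: orth_complement_def)
qed

section \<open>The positive square root\<close>

lemma positive_operatorI:
  assumes "S \<in> bounded_operators" "is_adjoint S S" "\<And>x. inner (S x) x \<ge> 0"
  shows "positive_operator S"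
proof -
  have "cinner (S x) x \<in> \<real>\<^sub>\<ge>\<^sub>0" for x
  proof -
    have "cnj (cinner (S x) x) = cinner (S x) x"
      using is_adjointD[OF assms(2), of x x] cinner_commute[of x "S x"] by simp
    then have "Im (cinner (S x) x) = 0"
      by (metis Reals_cnj_iff complex_is_Real_iff)
    then show ?thesis
      using assms(3)[of x] by (simp add: complex_nonneg_Reals_iff Re_cinner)
  qed
  then show ?thesis
    using assms(1) by (simp add: positive_operator_def)
qed

lemma positive_operatorD:
  assumes "positive_operator S"
  shows "S \<in> bounded_operators" "inner (S x) x \<ge> 0"
  using assms by (auto simp: positive_operator_def complex_nonneg_Reals_iff Re_cinner)

text \<open>The form \<open>h x y = \<langle>S x, y\<rangle> - \<langle>x, S y\<rangle>\<close> vanishes on the diagonal, because \<open>\<langle>S x, x\<rangle>\<close> is real.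
  Hence \<open>h x y + h y x = 0\<close>, and the same with \<open>\<i> x\<close> in place of \<open>x\<close> gives \<open>h x y - h y x = 0\<close>.\<close>

lemma positive_operator_selfadjoint:
  assumes S: "positive_operator S"
  shows "is_adjoint S S"
proof -
  note bS = positive_operatorD(1)[OF S]
  interpret S: bounded_linear S
    using bS by (rule bounded_operatorD)
  define h where "h x y = cinner (S x) y - cinner x (S y)" for x y
  have diag: "h x x = 0" for x
  proof -
    have "cinner (S x) x \<in> \<real>"
      using S nonneg_Reals_subset_Reals by (auto simp: positive_operator_def)
    then show ?thesis
      using cinner_commute[of x "S x"] by (simp add: h_def Reals_cnj_iff)
  qed
  have sum0: "h x y + h y x = 0" for x y
  proof -
    have "h (x + y) (x + y) = h x x + h y y + (h x y + h y x)"
      by (simp add: h_def S.add cinner_add_left cinner_add_right algebra_simps)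
    then show ?thesis
      by (simp add: diag)
  qed
  have "h x y = 0" for x y
  proof -
    have "h (\<i> *\<^sub>C x) y = \<i> * h x y" "h y (\<i> *\<^sub>C x) = - \<i> * h y x"
      by (simp_all add: h_def bounded_operatorD(2)[OF bS] cinner_scaleC_left cinner_scaleC_right
          algebra_simps)
    then have "\<i> * (h x y - h y x) = 0"
      using sum0[of "\<i> *\<^sub>C x" y] by (simp add: algebra_simps)
    then show ?thesis
      using sum0[of x y] by simp
  qed
  then show ?thesis
    by (simp add: is_adjoint_def h_def)
qed

text \<open>For real \<open>t\<close> the form of \<open>S\<close> at \<open>y - t S y\<close> is \<open>- 2 t \<parallel>S y\<parallel>\<^sup>2 + O(t\<^sup>2)\<close>, which is negative for
  small \<open>t > 0\<close> unless \<open>S y = 0\<close>.\<close>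

lemma positive_operator_kernel:
  assumes S: "positive_operator S" and y: "inner (S y) y = 0"
  shows "S y = 0"
proof -
  interpret S: bounded_linear S
    using positive_operatorD(1)[OF S] by (rule bounded_operatorD)
  define a where "a = (norm (S y))\<^sup>2"
  define b where "b = inner (S (S y)) (S y)"
  have "b \<ge> 0"
    unfolding b_def by (rule positive_operatorD(2)[OF S])
  have "inner (S (S y)) y = a"
    using is_adjointD[OF positive_operator_selfadjoint[OF S], of "S y" y]
    by (metis Re_cinner a_def power2_norm_eq_inner)
  then have quad: "2 * t * a \<le> t\<^sup>2 * b" for t
    using positive_operatorD(2)[OF S, of "y - t *\<^sub>R S y"] y
    by (simp add: S.diff S.scaleR inner_diff_left inner_diff_right power2_eq_square a_def b_def
        power2_norm_eq_inner[unfolded power2_eq_square] algebra_simps)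
  \<comment> \<open>A positive multiple of \<open>a\<close> is small enough as \<open>t\<close> once its factor is below \<open>2 / b\<close>.\<close>
  have "2 * a / (b + 1) * a \<le> (a / (b + 1))\<^sup>2 * b"
    using quad[of "a / (b + 1)"] by simp
  also have "\<dots> \<le> (a / (b + 1))\<^sup>2 * (b + 1)"
    by (simp add: mult_left_mono)
  also have "\<dots> = a / (b + 1) * a"
    using \<open>b \<ge> 0\<close> by (simp add: power2_eq_square)
  finally have "a * a / (b + 1) \<le> 0"
    by simp
  then have "a * a \<le> 0"
    using \<open>b \<ge> 0\<close> by (simp add: divide_le_0_iff)
  then have "a = 0"
    by (metis mult_eq_0_iff order_antisym zero_le_square)
  then show ?thesis
    by (simp add: a_def)
qed

text \<open>If \<open>Y = (B + Y\<^sup>2) / 2\<close> then \<open>(1 - Y)\<^sup>2 = 1 - B\<close>. The fixed point is found by iteration from \<open>0\<close>.\<close>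

primrec sqrt_iter :: "('a::real_vector \<Rightarrow> 'a) \<Rightarrow> nat \<Rightarrow> 'a \<Rightarrow> 'a" where
  "sqrt_iter B 0 = (\<lambda>x. 0)"
| "sqrt_iter B (Suc n) = (\<lambda>x. (1/2) *\<^sub>R (B x + sqrt_iter B n (sqrt_iter B n x)))"

text \<open>The same iteration for the scalar \<open>B = 1\<close>; it majorises the iteration for every contraction.\<close>

primrec sqrt_bound :: "nat \<Rightarrow> real" where
  "sqrt_bound 0 = 0"
| "sqrt_bound (Suc n) = (1 + (sqrt_bound n)\<^sup>2) / 2"

lemma sqrt_bound_bounds: "0 \<le> sqrt_bound n" "sqrt_bound n \<le> 1"
proof -
  have "0 \<le> sqrt_bound n \<and> sqrt_bound n \<le> 1"
    by (induction n) (auto simp: power_le_one)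
  then show "0 \<le> sqrt_bound n" "sqrt_bound n \<le> 1" by auto
qed

lemma Cauchy_sqrt_bound: "Cauchy sqrt_bound"
proof -
  have "incseq sqrt_bound"
  proof (rule incseq_SucI)
    fix n
    have "0 \<le> (1 - sqrt_bound n)\<^sup>2" by simp
    then show "sqrt_bound n \<le> sqrt_bound (Suc n)"
      by (simp add: power2_diff)
  qed
  then show ?thesis
    using incseq_convergent[of sqrt_bound 1] sqrt_bound_bounds(2)
    by (metis LIMSEQ_imp_Cauchy)
qed

lemma sqrt_iter_bounded_operators:
  assumes "B \<in> bounded_operators"
  shows "sqrt_iter B n \<in> bounded_operators"
proof (induction n)
  case 0
  then show ?case
    by (simp add: bounded_operators_def bounded_linear_zero scaleC.zero_right)
next
  case (Suc n)
  have "(\<lambda>x. B x + sqrt_iter B n (sqrt_iter B n x)) \<in> bounded_operators"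
    using assms bounded_operators_comp[OF Suc Suc]
    by (auto simp: bounded_operators_def bounded_linear_add scaleC_add_right comp_def)
  then show ?case
    by (simp add: bounded_operators_scaleR)
qed

lemma sqrt_iter_selfadjoint:
  assumes "is_adjoint B B"
  shows "is_adjoint (sqrt_iter B n) (sqrt_iter B n)"
proof (induction n)
  case 0
  then show ?case
    by (simp add: is_adjoint_def cinner.zero_left cinner.zero_right)
next
  case (Suc n)
  show ?case
    unfolding is_adjoint_def
    by (simp add: cinner.scaleR_left cinner.scaleR_right cinner.add_left cinner.add_right
        is_adjointD[OF assms] is_adjointD[OF Suc])
qed

text \<open>The difference of consecutive iterates is
  \<open>Y\<^sub>n\<^sub>+\<^sub>1 - Y\<^sub>n = (Y\<^sub>n (Y\<^sub>n - Y\<^sub>n\<^sub>-\<^sub>1) + (Y\<^sub>n - Y\<^sub>n\<^sub>-\<^sub>1) Y\<^sub>n\<^sub>-\<^sub>1) / 2\<close>, and the scalar differences satisfy the same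
  recursion.\<close>

lemma
  assumes B: "B \<in> bounded_operators" and contr: "\<And>x. norm (B x) \<le> norm x"
  shows norm_sqrt_iter_le: "norm (sqrt_iter B n x) \<le> sqrt_bound n * norm x"
    and norm_sqrt_iter_Suc_diff_le: "norm (sqrt_iter B (Suc n) x - sqrt_iter B n x)
      \<le> (sqrt_bound (Suc n) - sqrt_bound n) * norm x"
proof -
  let ?Y = "sqrt_iter B" and ?b = sqrt_bound
  have bound: "norm (?Y n x) \<le> ?b n * norm x" for n x
  proof (induction n arbitrary: x)
    case (Suc n)
    have "norm (?Y n (?Y n x)) \<le> ?b n * (?b n * norm x)"
      using Suc[of "?Y n x"] Suc[of x] mult_left_mono[OF Suc[of x] sqrt_bound_bounds(1)[of n]]
      by linarith
    then have "norm (B x + ?Y n (?Y n x)) \<le> norm x + ?b n * (?b n * norm x)"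
      using contr[of x] norm_triangle_ineq[of "B x" "?Y n (?Y n x)"] by linarith
    then show ?case
      unfolding sqrt_iter.simps norm_scaleR sqrt_bound.simps
      by (simp add: power2_eq_square algebra_simps)
  qed simp
  show "norm (?Y n x) \<le> ?b n * norm x"
    by (rule bound)
  show "norm (?Y (Suc n) x - ?Y n x) \<le> (?b (Suc n) - ?b n) * norm x"
  proof (induction n arbitrary: x)
    case 0
    then show ?case
      using contr by simp
  next
    case (Suc n)
    let ?D = "\<lambda>x. ?Y (Suc n) x - ?Y n x"
    let ?d = "?b (Suc n) - ?b n"
    have "?d \<ge> 0"
    proof -
      have "0 \<le> (1 - ?b n)\<^sup>2" by simp
      then show ?thesis
        by (simp add: power2_diff)
    qed
    have lin: "bounded_linear (?Y (Suc n))"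
      using sqrt_iter_bounded_operators[OF B] by (rule bounded_operatorD)
    have "?Y (Suc (Suc n)) x - ?Y (Suc n) x = (1/2) *\<^sub>R (?Y (Suc n) (?D x) + ?D (?Y n x))"
      unfolding linear_diff[OF bounded_linear.linear[OF lin]]
      unfolding sqrt_iter.simps(2)[of B "Suc n"]
      by (subst (5) sqrt_iter.simps(2)) (simp add: algebra_simps)
    then have "norm (?Y (Suc (Suc n)) x - ?Y (Suc n) x)
        \<le> (1/2) * (norm (?Y (Suc n) (?D x)) + norm (?D (?Y n x)))"
      using norm_triangle_ineq[of "?Y (Suc n) (?D x)" "?D (?Y n x)"] by simp
    also have "\<dots> \<le> (1/2) * (?b (Suc n) * (?d * norm x) + ?d * (?b n * norm x))"
    proof -
      have "norm (?Y (Suc n) (?D x)) \<le> ?b (Suc n) * (?d * norm x)"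
        using bound[of "Suc n" "?D x"] mult_left_mono[OF Suc[of x] sqrt_bound_bounds(1)[of "Suc n"]]
        by linarith
      moreover have "norm (?D (?Y n x)) \<le> ?d * (?b n * norm x)"
        using Suc[of "?Y n x"] mult_left_mono[OF bound[of n x] \<open>?d \<ge> 0\<close>] by linarith
      ultimately show ?thesis
        by (intro mult_left_mono add_mono) auto
    qed
    also have "\<dots> = (1/2) * ((?b (Suc n) + ?b n) * ?d) * norm x"
      by (simp only: algebra_simps)
    also have "(1/2) * ((?b (Suc n) + ?b n) * ?d) = ?b (Suc (Suc n)) - ?b (Suc n)"
    proof -
      have "2 * ?b (Suc n) = 1 + (?b n)\<^sup>2" by simp
      then show ?thesis
        unfolding sqrt_bound.simps(2)[of "Suc n"]
        by (simp del: sqrt_bound.simps add: power2_eq_square field_simps)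
    qed
    finally show ?case .
  qed
qed

text \<open>The iterates are polynomials in \<open>B\<close>, so every closed subspace that is invariant under \<open>B\<close>
  is invariant under the limit, and every operator that commutes with \<open>B\<close> commutes with it.\<close>

lemma sqrt_of_one_minus_contraction:
  fixes B :: "'a::complex_hilbert_space \<Rightarrow> 'a"
  assumes B: "B \<in> bounded_operators" "is_adjoint B B" and contr: "\<And>x. norm (B x) \<le> norm x"
  obtains S where "positive_operator S" "\<And>x. S (S x) = x - B x"
    "\<And>M. complex_vector.subspace M \<Longrightarrow> closed M \<Longrightarrow> B ` M \<subseteq> M \<Longrightarrow> S ` M \<subseteq> M"
    "\<And>C x. bounded_linear C \<Longrightarrow> (\<And>x. C (B x) = B (C x)) \<Longrightarrow> C (S x) = S (C x)"
proof -
  let ?Y = "sqrt_iter B"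
  have "Cauchy (\<lambda>n. ?Y n x)" for x
  proof -
    have diff: "norm (?Y (n + k) x - ?Y n x) \<le> (sqrt_bound (n + k) - sqrt_bound n) * norm x" for n k
    proof (induction k)
      case (Suc k)
      have "norm (?Y (n + Suc k) x - ?Y n x)
          \<le> norm (?Y (Suc (n + k)) x - ?Y (n + k) x) + norm (?Y (n + k) x - ?Y n x)"
        using norm_triangle_ineq[of "?Y (Suc (n + k)) x - ?Y (n + k) x" "?Y (n + k) x - ?Y n x"]
        by (simp del: sqrt_iter.simps)
      also have "\<dots> \<le> (sqrt_bound (Suc (n + k)) - sqrt_bound (n + k)) * norm x
          + (sqrt_bound (n + k) - sqrt_bound n) * norm x"
        by (intro add_mono norm_sqrt_iter_Suc_diff_le B contr Suc)
      also have "\<dots> = (sqrt_bound (n + Suc k) - sqrt_bound n) * norm x"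
        by (simp del: sqrt_bound.simps add: algebra_simps)
      finally show ?case .
    qed simp
    have "Cauchy (\<lambda>n. sqrt_bound n * norm x)"
      using bounded_linear.Cauchy[OF bounded_linear_mult_left Cauchy_sqrt_bound] .
    have "dist (?Y m x) (?Y n x) \<le> dist (sqrt_bound m * norm x) (sqrt_bound n * norm x)" for m n
    proof (induction m n rule: linorder_wlog)
      case (le m n)
      then show ?case
        using diff[of m "n - m"] by (simp add: dist_norm norm_minus_commute algebra_simps)
    qed (simp add: dist_commute)
    then show ?thesis
      using \<open>Cauchy (\<lambda>n. sqrt_bound n * norm x)\<close> unfolding Cauchy_def
      by (meson order.strict_trans1)
  qed
  then have conv: "convergent (\<lambda>n. ?Y n x)" for x
    by (rule Cauchy_convergent)
  define Y where "Y x = lim (\<lambda>n. ?Y n x)" for x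
  have Y: "(\<lambda>n. ?Y n x) \<longlonglongrightarrow> Y x" for x
    unfolding Y_def using conv by (simp only: convergent_LIMSEQ_iff)
  have bY: "?Y n \<in> bounded_operators" for n
    by (rule sqrt_iter_bounded_operators[OF B(1)])
  have norm_iter: "norm (?Y n x) \<le> norm x" for n x
    using norm_sqrt_iter_le[OF B(1) contr, of n x]
      mult_right_mono[OF sqrt_bound_bounds(2)[of n] norm_ge_zero[of x]] by simp
  have norm_Y: "norm (Y x) \<le> norm x" for x
    by (rule LIMSEQ_le_const2[OF tendsto_norm[OF Y]]) (use norm_iter in blast)
  have adj: "is_adjoint Y Y"
    unfolding is_adjoint_def
  proof (intro allI)
    fix x y
    have "(\<lambda>n. cinner (?Y n x) y) \<longlonglongrightarrow> cinner (Y x) y"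
      by (intro cinner.tendsto Y tendsto_const)
    moreover have "(\<lambda>n. cinner (?Y n x) y) \<longlonglongrightarrow> cinner x (Y y)"
      unfolding is_adjointD[OF sqrt_iter_selfadjoint[OF B(2)]]
      by (intro cinner.tendsto Y tendsto_const)
    ultimately show "cinner (Y x) y = cinner x (Y y)"
      by (rule LIMSEQ_unique)
  qed
  have Y_scaleC: "Y (c *\<^sub>C x) = c *\<^sub>C Y x" for c x
  proof (rule LIMSEQ_unique[OF Y])
    show "(\<lambda>n. ?Y n (c *\<^sub>C x)) \<longlonglongrightarrow> c *\<^sub>C Y x"
      unfolding bounded_operatorD(2)[OF bY] by (intro scaleC.tendsto Y tendsto_const)
  qed
  have Y_lin: "bounded_linear Y"
  proof (rule bounded_linear_intro[where K = 1])
    show "Y (x + y) = Y x + Y y" for x y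
    proof (rule LIMSEQ_unique[OF Y])
      show "(\<lambda>n. ?Y n (x + y)) \<longlonglongrightarrow> Y x + Y y"
        unfolding linear_add[OF bounded_linear.linear[OF bounded_operatorD(1)[OF bY]]]
        by (intro tendsto_add Y)
    qed
    show "Y (r *\<^sub>R x) = r *\<^sub>R Y x" for r x
      using Y_scaleC[of "of_real r" x] by (simp add: scaleC_of_real)
  qed (simp add: norm_Y)
  have Y_fix: "Y x = (1/2) *\<^sub>R (B x + Y (Y x))" for x
  proof (rule LIMSEQ_unique[OF LIMSEQ_Suc[OF Y]])
    have "(\<lambda>n. ?Y n (?Y n x - Y x)) \<longlonglongrightarrow> 0"
    proof (rule Lim_null_comparison)
      show "\<forall>\<^sub>F n in sequentially. norm (?Y n (?Y n x - Y x)) \<le> norm (?Y n x - Y x)"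
        by (simp add: norm_iter)
      show "(\<lambda>n. norm (?Y n x - Y x)) \<longlonglongrightarrow> 0"
        using Y[of x] by (simp add: LIM_zero tendsto_norm_zero)
    qed
    from tendsto_add[OF this Y[of "Y x"]] have "(\<lambda>n. ?Y n (?Y n x)) \<longlonglongrightarrow> Y (Y x)"
      by (simp add: linear_diff[OF bounded_linear.linear[OF bounded_operatorD(1)[OF bY]]])
    then show "(\<lambda>n. ?Y (Suc n) x) \<longlonglongrightarrow> (1/2) *\<^sub>R (B x + Y (Y x))"
      by (simp, intro tendsto_intros)
  qed
  define S where "S = (\<lambda>x. x - Y x)"
  show thesis
  proof (rule that)
    show "positive_operator S"
    proof (rule positive_operatorI)
      show "S \<in> bounded_operators"
        unfolding S_def using Y_lin Y_scaleC
        by (intro bounded_operators_diff bounded_operators_ident) (simp add: bounded_operators_def)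
      show "is_adjoint S S"
        unfolding S_def is_adjoint_def
        by (simp add: cinner.diff_left cinner.diff_right is_adjointD[OF adj])
      show "inner (S x) x \<ge> 0" for x
        using norm_cauchy_schwarz[of "Y x" x] mult_right_mono[OF norm_Y norm_ge_zero, of x x]
        by (simp add: S_def inner_diff_left power2_norm_eq_inner[symmetric] power2_eq_square)
    qed
    show "S (S x) = x - B x" for x
    proof -
      have "B x = 2 *\<^sub>R Y x - Y (Y x)"
        by (subst (1) Y_fix) simp
      then show ?thesis
        by (simp add: S_def linear_diff[OF bounded_linear.linear[OF Y_lin]] scaleR_2)
    qed
    show "S ` M \<subseteq> M" if M: "complex_vector.subspace M" "closed M" "B ` M \<subseteq> M" for M
    proof
      fix y assume "y \<in> S ` M"
      then obtain x where x: "x \<in> M" and y: "y = x - Y x"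
        by (auto simp: S_def)
      have "?Y n x \<in> M" if "x \<in> M" for n x
        using that
      proof (induction n arbitrary: x)
        case (Suc n)
        then show ?case
          using M by (auto intro!: complex_subspace_scaleR complex_vector.subspace_add)
      qed (simp add: complex_vector.subspace_0[OF M(1)])
      then have "Y x \<in> M"
        using closed_sequentially[OF M(2) _ Y] x by blast
      then show "y \<in> M"
        unfolding y using M(1) x by (intro complex_vector.subspace_diff)
    qed
    show "C (S x) = S (C x)" if C: "bounded_linear C" "\<And>x. C (B x) = B (C x)" for C x
    proof -
      interpret C: bounded_linear C by (rule C(1))
      have iter: "C (?Y n x) = ?Y n (C x)" for n x
        by (induction n arbitrary: x) (simp_all add: C.scaleR C.add C.zero C(2))
      have "C (Y x) = Y (C x)"
        using C.tendsto[OF Y[of x]] Y[of "C x"] unfolding iter by (rule LIMSEQ_unique)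
      then show ?thesis
        by (simp add: S_def C.diff)
    qed
  qed
qed

text \<open>After scaling to \<open>\<parallel>T\<parallel> \<le> 1\<close> the operator \<open>1 - T\<^sup>* T\<close> is a contraction:
  \<open>\<parallel>x - T\<^sup>* T x\<parallel>\<^sup>2 = \<parallel>x\<parallel>\<^sup>2 - 2 \<parallel>T x\<parallel>\<^sup>2 + \<parallel>T\<^sup>* T x\<parallel>\<^sup>2 \<le> \<parallel>x\<parallel>\<^sup>2\<close>.\<close>

lemma sqrt_adjoint_mult_self_exists:
  fixes T :: "'a::complex_hilbert_space \<Rightarrow> 'a"
  assumes T: "T \<in> bounded_operators" and adj: "is_adjoint T T'"
  obtains S where "positive_operator S" "S \<circ> S = T' \<circ> T"
    "\<And>M. complex_vector.subspace M \<Longrightarrow> closed M \<Longrightarrow> (T' \<circ> T) ` M \<subseteq> M \<Longrightarrow> S ` M \<subseteq> M"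
    "\<And>C x. bounded_linear C \<Longrightarrow> (\<And>x. C (T' (T x)) = T' (T (C x))) \<Longrightarrow> C (S x) = S (C x)"
proof -
  obtain K where "K > 0" and K: "\<And>x. norm (T x) \<le> norm x * K"
    using bounded_linear.pos_bounded[OF bounded_operatorD(1)[OF T]] by blast
  define B where "B x = x - (1 / K\<^sup>2) *\<^sub>R T' (T x)" for x
  have T': "T' \<in> bounded_operators"
    using adj T by (rule is_adjoint_bounded_operators)
  have norm_T': "norm (T' y) \<le> K * norm y" for y
    using is_adjoint_norm_le[OF adj, of K y] K by (simp add: mult.commute)
  have "B \<in> bounded_operators"
    unfolding B_def using bounded_operators_comp[OF T' T]
    by (intro bounded_operators_diff bounded_operators_scaleR bounded_operators_ident)
      (simp add: comp_def)
  moreover have "is_adjoint B B"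
    unfolding is_adjoint_def B_def
    by (simp add: cinner.diff_left cinner.diff_right cinner.scaleR_left cinner.scaleR_right
        is_adjointD[OF adj] is_adjointD[OF is_adjoint_sym[OF adj]])
  moreover have "norm (B x) \<le> norm x" for x
  proof -
    define u where "u = (1 / K\<^sup>2) *\<^sub>R T' (T x)"
    define s where "s = (norm (T x))\<^sup>2 / K\<^sup>2"
    have "s \<ge> 0"
      by (simp add: s_def)
    have "inner x (T' (T x)) = (norm (T x))\<^sup>2"
      using is_adjointD[OF adj, of x "T x"] by (metis Re_cinner power2_norm_eq_inner)
    then have xu: "inner x u = s"
      by (simp add: u_def s_def)
    have "norm u \<le> (1 / K\<^sup>2) * (K * norm (T x))"
      using mult_left_mono[OF norm_T'[of "T x"], of "1 / K\<^sup>2"] by (simp add: u_def)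
    also have "\<dots> = norm (T x) / K"
      using \<open>K > 0\<close> by (simp add: power2_eq_square)
    finally have "(norm u)\<^sup>2 \<le> s"
      using power_mono[of "norm u" "norm (T x) / K" 2] by (simp add: s_def power_divide)
    have "(norm (B x))\<^sup>2 = (norm x)\<^sup>2 - 2 * s + (norm u)\<^sup>2"
      unfolding B_def u_def[symmetric] power2_norm_eq_inner xu[symmetric]
      by (simp add: inner_diff_left inner_diff_right inner_commute)
    also have "\<dots> \<le> (norm x)\<^sup>2"
      using \<open>(norm u)\<^sup>2 \<le> s\<close> \<open>s \<ge> 0\<close> by linarith
    finally show ?thesis
      by (rule power2_le_imp_le) simp
  qed
  ultimately obtain R where R: "positive_operator R" and RR: "\<And>x. R (R x) = x - B x"
    and inv: "\<And>M. complex_vector.subspace M \<Longrightarrow> closed M \<Longrightarrow> B ` M \<subseteq> M \<Longrightarrow> R ` M \<subseteq> M"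
    and com: "\<And>C x. bounded_linear C \<Longrightarrow> (\<And>x. C (B x) = B (C x)) \<Longrightarrow> C (R x) = R (C x)"
    using sqrt_of_one_minus_contraction by blast
  note bR = positive_operatorD(1)[OF R]
  interpret R: bounded_linear R
    by (rule bounded_operatorD[OF bR])
  define S where "S = (\<lambda>x. K *\<^sub>R R x)"
  show thesis
  proof (rule that)
    show "positive_operator S"
    proof (rule positive_operatorI)
      show "S \<in> bounded_operators"
        unfolding S_def by (rule bounded_operators_scaleR[OF bR])
      show "is_adjoint S S"
        unfolding is_adjoint_def S_def
        by (simp add: cinner.scaleR_left cinner.scaleR_right
            is_adjointD[OF positive_operator_selfadjoint[OF R]])
      show "inner (S x) x \<ge> 0" for x
        using positive_operatorD(2)[OF R, of x] \<open>K > 0\<close> by (simp add: S_def)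
    qed
    show "S \<circ> S = T' \<circ> T"
      using \<open>K > 0\<close> by (auto simp: S_def R.scaleR RR B_def power2_eq_square)
    show "S ` M \<subseteq> M" if M: "complex_vector.subspace M" "closed M" "(T' \<circ> T) ` M \<subseteq> M" for M
    proof -
      have "B ` M \<subseteq> M"
        using M by (auto simp: B_def intro!: complex_vector.subspace_diff complex_subspace_scaleR)
      then show ?thesis
        using inv[OF M(1,2)] M(1) by (auto simp: S_def intro!: complex_subspace_scaleR)
    qed
    show "C (S x) = S (C x)" if C: "bounded_linear C" "\<And>x. C (T' (T x)) = T' (T (C x))" for C x
    proof -
      interpret C: bounded_linear C by (rule C(1))
      have "C (B x) = B (C x)" for x
        by (simp add: B_def C.diff C.scaleR C(2))
      then show ?thesis
        using com[OF C(1)] by (simp add: S_def C.scaleR)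
    qed
  qed
qed

text \<open>Two commuting positive operators with the same square agree: for \<open>y = S x - R x\<close> one has
  \<open>(S + R) y = (S\<^sup>2 - R\<^sup>2) x = 0\<close>, so both forms vanish at \<open>y\<close> and hence \<open>S y = R y = 0\<close>; then
  \<open>\<parallel>y\<parallel>\<^sup>2 = \<langle>x, (S - R) y\<rangle> = 0\<close>.\<close>

lemma commuting_positive_sqrt_unique:
  assumes S: "positive_operator S" and R: "positive_operator R"
    and sq: "S \<circ> S = R \<circ> R" and com: "\<And>x. R (S x) = S (R x)"
  shows "S = R"
proof
  fix x
  interpret S: bounded_linear S
    using positive_operatorD(1)[OF S] by (rule bounded_operatorD)
  interpret R: bounded_linear R
    using positive_operatorD(1)[OF R] by (rule bounded_operatorD)
  define y where "y = S x - R x"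
  have "S y + R y = 0"
    using fun_cong[OF sq, of x] com[of x] by (simp add: y_def S.diff R.diff)
  then have "inner (S y) y + inner (R y) y = 0"
    by (metis inner_add_left inner_zero_left)
  then have "inner (S y) y = 0" "inner (R y) y = 0"
    using positive_operatorD(2)[OF S, of y] positive_operatorD(2)[OF R, of y] by linarith+
  then have "S y = 0" "R y = 0"
    using positive_operator_kernel S R by blast+
  then have "cinner y y = 0"
    using is_adjointD[OF positive_operator_selfadjoint[OF S], of x y]
      is_adjointD[OF positive_operator_selfadjoint[OF R], of x y]
    by (simp add: y_def[symmetric] cinner.diff_left[of "S x" "R x" y, folded y_def] cinner.zero_right)
  then show "S x = R x"
    by (simp add: cinner_self y_def)
qed

text \<open>Any positive square root \<open>R\<close> of \<open>T\<^sup>* T\<close> commutes with \<open>T\<^sup>* T = R\<^sup>2\<close>, hence with the one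
  constructed above, which is therefore the only one.\<close>

lemma abs_operator_unique:
  fixes T :: "'a::complex_hilbert_space \<Rightarrow> 'a"
  assumes T: "T \<in> bounded_operators" and adj: "is_adjoint T T'"
  shows abs_operator_positive: "positive_operator (abs_operator T)"
    and abs_operator_square: "abs_operator T \<circ> abs_operator T = T' \<circ> T"
    and abs_operator_eqI: "positive_operator R \<Longrightarrow> R \<circ> R = T' \<circ> T \<Longrightarrow> abs_operator T = R"
    and abs_operator_invariant: "complex_vector.subspace M \<Longrightarrow> closed M \<Longrightarrow> (T' \<circ> T) ` M \<subseteq> M
      \<Longrightarrow> abs_operator T ` M \<subseteq> M"
proof -
  obtain S where S: "positive_operator S" "S \<circ> S = T' \<circ> T"
    and inv: "\<And>M. complex_vector.subspace M \<Longrightarrow> closed M \<Longrightarrow> (T' \<circ> T) ` M \<subseteq> M \<Longrightarrow> S ` M \<subseteq> M"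
    and com: "\<And>C x. bounded_linear C \<Longrightarrow> (\<And>x. C (T' (T x)) = T' (T (C x))) \<Longrightarrow> C (S x) = S (C x)"
    using sqrt_adjoint_mult_self_exists[OF T adj] by blast
  have unique: "R = S" if R: "positive_operator R" "R \<circ> R = T' \<circ> T" for R
  proof (rule commuting_positive_sqrt_unique[symmetric])
    have "R (T' (T x)) = T' (T (R x))" for x
      using fun_cong[OF R(2)] by (metis comp_apply)
    then show "R (S x) = S (R x)" for x
      by (rule com[OF bounded_operatorD(1)[OF positive_operatorD(1)[OF R(1)]]])
  qed (use S R in simp_all)
  have abs: "abs_operator T = S"
    unfolding abs_operator_def sqrt_operator_def cadjoint_eqI[OF adj]
  proof (rule the_equality)
    show "positive_operator S \<and> S \<circ> S = T' \<circ> T"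
      using S by blast
    show "R = S" if "positive_operator R \<and> R \<circ> R = T' \<circ> T" for R
      using that by (intro unique) blast+
  qed
  show "positive_operator (abs_operator T)" "abs_operator T \<circ> abs_operator T = T' \<circ> T"
    using S by (simp_all add: abs)
  show "abs_operator T = R" if "positive_operator R" "R \<circ> R = T' \<circ> T"
    using unique[OF that] by (simp add: abs)
  show "abs_operator T ` M \<subseteq> M"
    if "complex_vector.subspace M" "closed M" "(T' \<circ> T) ` M \<subseteq> M"
    using inv[OF that] by (simp add: abs)
qed

lemma norm_abs_operator:
  fixes T :: "'a::complex_hilbert_space \<Rightarrow> 'a"
  assumes T: "T \<in> bounded_operators"
  shows "norm (abs_operator T x) = norm (T x)"
proof -
  obtain T' where adj: "is_adjoint T T'"
    using adjoint_exists[OF T] .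
  let ?S = "abs_operator T"
  have "cinner (?S x) (?S x) = cinner x (T' (T x))"
    using is_adjointD[OF positive_operator_selfadjoint[OF abs_operator_positive[OF T adj]]]
      fun_cong[OF abs_operator_square[OF T adj], of x] by simp
  also have "\<dots> = cinner (T x) (T x)"
    using is_adjointD[OF adj] by simp
  finally have "(norm (?S x))\<^sup>2 = (norm (T x))\<^sup>2"
    by (simp only: cinner_self of_real_eq_iff)
  then show ?thesis
    by (simp add: power2_eq_iff_nonneg)
qed

section \<open>Reducing subspaces and norm attainment\<close>

lemma reducing_subspacesD:
  assumes "M \<in> reducing_subspaces T"
  shows "complex_vector.subspace M" "closed M" "T ` M \<subseteq> M"
    "T ` orth_complement M \<subseteq> orth_complement M"
  using assms by (auto simp: reducing_subspaces_def)

lemma selfadjoint_reducingI: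
  assumes "complex_vector.subspace M" "closed M" "T ` M \<subseteq> M" "is_adjoint T T"
  shows "M \<in> reducing_subspaces T"
  using assms is_adjoint_orth_complement by (simp add: reducing_subspaces_def)

text \<open>A subspace \<open>M\<close> that reduces \<open>T\<close> is invariant under \<open>T\<^sup>*\<close>, since \<open>M\<close> is the complement of the
  \<open>T\<close>-invariant space \<open>M\<^sup>\<bottom>\<close>. So it is invariant under \<open>T\<^sup>* T\<close> and hence under the square root.\<close>

lemma reducing_abs_operator:
  fixes T :: "'a::complex_hilbert_space \<Rightarrow> 'a"
  assumes T: "T \<in> bounded_operators" and M: "M \<in> reducing_subspaces T"
  shows "M \<in> reducing_subspaces (abs_operator T)"
proof -
  obtain T' where adj: "is_adjoint T T'"
    using adjoint_exists[OF T] .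
  note M' = reducing_subspacesD[OF M]
  have "T' ` M \<subseteq> M"
    using is_adjoint_orth_complement[OF adj M'(4)] by (simp add: double_orth_complement M')
  then have "(T' \<circ> T) ` M \<subseteq> M"
    using M'(3) by auto
  then have "abs_operator T ` M \<subseteq> M"
    by (rule abs_operator_invariant[OF T adj M'(1,2)])
  then show ?thesis
    by (intro selfadjoint_reducingI M' positive_operator_selfadjoint abs_operator_positive[OF T adj])
qed

lemma norm_attaining_on_abs_operator:
  fixes T :: "'a::complex_hilbert_space \<Rightarrow> 'a"
  assumes "T \<in> bounded_operators"
  shows "norm_attaining_on (abs_operator T) M \<longleftrightarrow> norm_attaining_on T M"
  by (simp add: norm_attaining_on_def restriction_norm_def norm_abs_operator[OF assms])

lemma beta_class_if_abs_operator:
  fixes T :: "'a::complex_hilbert_space \<Rightarrow> 'a"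
  assumes "T \<in> bounded_operators" "abs_operator T \<in> beta_class"
  shows "T \<in> beta_class"
  using assms reducing_abs_operator norm_attaining_on_abs_operator unfolding beta_class_def by blast

lemma norm_le_restriction_norm:
  assumes "bounded_linear T" "x \<in> M" "norm x = 1"
  shows "norm (T x) \<le> restriction_norm T M"
proof -
  obtain K where K: "\<And>x. norm (T x) \<le> norm x * K"
    using bounded_linear.bounded[OF assms(1)] by blast
  have "bdd_above ((\<lambda>y. norm (T y)) ` {y \<in> M. norm y = 1})"
    by (rule bdd_aboveI[where M = K]) (auto, metis K mult_1)
  then show ?thesis
    unfolding restriction_norm_def using assms by (intro cSUP_upper) auto
qed

lemma norm_attaining_onI:
  assumes "bounded_linear T" "x \<in> M" "norm x = 1"
    and le: "\<And>y. y \<in> M \<Longrightarrow> norm y = 1 \<Longrightarrow> norm (T y) \<le> norm (T x)"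
  shows "norm_attaining_on T M"
proof -
  have "restriction_norm T M \<le> norm (T x)"
    unfolding restriction_norm_def using assms by (intro cSUP_least) auto
  then show ?thesis
    unfolding norm_attaining_on_def using assms norm_le_restriction_norm by (metis order_antisym)
qed

section \<open>Orthonormal sequences and diagonal operators\<close>

definition orthonormal_seq :: "(nat \<Rightarrow> 'a::complex_inner) \<Rightarrow> bool" where
  "orthonormal_seq e \<longleftrightarrow> (\<forall>i j. cinner (e i) (e j) = of_bool (i = j))"

lemma orthonormal_seqD: "orthonormal_seq e \<Longrightarrow> cinner (e i) (e j) = of_bool (i = j)"
  by (simp add: orthonormal_seq_def)

lemma orthonormal_seq_norm:
  assumes "orthonormal_seq e"
  shows "norm (e n) = 1"
  using orthonormal_seqD[OF assms, of n n] by (simp add: norm_eq_sqrt_cinner)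

text \<open>A maximal orthonormal set is infinite: if it were finite, then subtracting from a vector
  outside its span the components along the set would leave a nonzero vector orthogonal to the
  whole set.\<close>

lemma orthonormal_seq_exists:
  assumes inf: "infinite_dimensional TYPE('a::complex_inner)"
  obtains e :: "nat \<Rightarrow> 'a::complex_inner" where "orthonormal_seq e"
proof -
  define ortho where
    "ortho B \<longleftrightarrow> (\<forall>x\<in>B. \<forall>y\<in>B. cinner x y = of_bool (x = y))" for B :: "'a set"
  have "\<exists>B\<in>Collect ortho. \<forall>X\<in>Collect ortho. B \<subseteq> X \<longrightarrow> X = B"
  proof (rule subset_Zorn')
    fix C assume C: "subset.chain (Collect ortho) C"
    have "cinner x y = of_bool (x = y)" if "X \<in> C" "Y \<in> C" "x \<in> X" "y \<in> Y" for x y X Y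
    proof -
      have "X \<subseteq> Y \<or> Y \<subseteq> X" "ortho X" "ortho Y"
        using C that by (auto simp: subset.chain_def)
      then show ?thesis
        using that unfolding ortho_def by blast
    qed
    then show "\<Union>C \<in> Collect ortho"
      unfolding ortho_def by blast
  qed
  then obtain B where B: "ortho B" and max: "\<And>X. ortho X \<Longrightarrow> B \<subseteq> X \<Longrightarrow> X = B"
    by auto
  have "infinite B"
  proof
    assume fin: "finite B"
    have "x \<in> complex_vector.span B" for x
    proof -
      define s where "s = (\<Sum>b\<in>B. cinner x b *\<^sub>C b)"
      define r where "r = x - s"
      have orth: "cinner r c = 0" if "c \<in> B" for c
      proof -
        have "cinner s c = (\<Sum>b\<in>B. cinner x b * cinner b c)"
          by (simp add: s_def cinner.sum_left cinner_scaleC_left)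
        also have "\<dots> = (\<Sum>b\<in>B. if b = c then cinner x b else 0)"
          using B that by (intro sum.cong) (auto simp: ortho_def)
        also have "\<dots> = cinner x c"
          using fin that by simp
        finally show ?thesis
          by (simp add: r_def cinner.diff_left)
      qed
      have "r = 0"
      proof (rule ccontr)
        assume "r \<noteq> 0"
        define u where "u = (1 / norm r) *\<^sub>R r"
        have u_self: "cinner u u = 1"
          using \<open>r \<noteq> 0\<close> by (simp add: cinner_self u_def)
        have u_orth: "cinner u c = 0" "cinner c u = 0" if "c \<in> B" for c
          using orth[OF that] cinner_commute[of c r]
          by (simp_all add: u_def cinner.scaleR_left cinner.scaleR_right)
        have "ortho (insert u B)"
          unfolding ortho_def
        proof (intro ballI)
          fix y z assume yz: "y \<in> insert u B" "z \<in> insert u B"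
          have "u \<notin> B"
            using u_orth(1)[of u] u_self by auto
          then show "cinner y z = of_bool (y = z)"
            using yz B u_self u_orth by (auto simp: ortho_def)
        qed
        then have "u \<in> B"
          using max by blast
        then show False
          using u_orth(1)[of u] u_self by simp
      qed
      then have "x = s"
        by (simp add: r_def)
      moreover have "s \<in> complex_vector.span B"
        unfolding s_def
        by (intro complex_vector.span_sum complex_vector.span_scale complex_vector.span_base)
      ultimately show ?thesis
        by simp
    qed
    then show False
      using inf fin by (auto simp: infinite_dimensional_def)
  qed
  then obtain e :: "nat \<Rightarrow> 'a" where e: "inj e" "range e \<subseteq> B"
    using infinite_countable_subset by blast
  have "cinner (e i) (e j) = of_bool (i = j)" for i j
  proof -
    have "e i \<in> B" "e j \<in> B"
      using e(2) by auto
    then show ?thesis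
      using B e(1) by (simp add: ortho_def inj_eq)
  qed
  then show ?thesis
    using that[of e] by (simp add: orthonormal_seq_def)
qed

text \<open>The operator that multiplies \<open>e n\<close> by \<open>1 - a n\<close> and fixes every vector orthogonal to all
  \<open>e n\<close>. Perturbing the identity by absolutely summable eigenvalues makes the series converge
  absolutely.\<close>

definition diag_op :: "(nat \<Rightarrow> 'a::complex_hilbert_space) \<Rightarrow> (nat \<Rightarrow> real) \<Rightarrow> 'a \<Rightarrow> 'a" where
  "diag_op e a x = x - (\<Sum>n. a n *\<^sub>R (cinner x (e n) *\<^sub>C e n))"

context
  fixes e :: "nat \<Rightarrow> 'a::complex_hilbert_space" and a :: "nat \<Rightarrow> real"
  assumes e: "orthonormal_seq e" and a: "summable (\<lambda>n. \<bar>a n\<bar>)"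
begin

private definition pert :: "'a \<Rightarrow> 'a" where
  "pert x = (\<Sum>n. a n *\<^sub>R (cinner x (e n) *\<^sub>C e n))"

private lemma norm_term_le: "norm (a n *\<^sub>R (cinner x (e n) *\<^sub>C e n)) \<le> \<bar>a n\<bar> * norm x"
  using norm_cinner_le[of x "e n"]
  by (simp add: norm_scaleC orthonormal_seq_norm[OF e] mult_left_mono)

private lemma summable_norm_term: "summable (\<lambda>n. norm (a n *\<^sub>R (cinner x (e n) *\<^sub>C e n)))"
  by (rule summable_comparison_test'[OF summable_mult2[OF a, of "norm x"]])
    (use norm_term_le in simp)

private lemma pert_sums: "(\<lambda>n. a n *\<^sub>R (cinner x (e n) *\<^sub>C e n)) sums pert x"
  unfolding pert_def by (rule summable_sums[OF summable_norm_cancel[OF summable_norm_term]])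

private lemma pert_bounded_operator: "pert \<in> bounded_operators"
proof -
  have scaleC: "pert (c *\<^sub>C x) = c *\<^sub>C pert x" for c x
  proof (rule sums_unique2[OF pert_sums])
    show "(\<lambda>n. a n *\<^sub>R (cinner (c *\<^sub>C x) (e n) *\<^sub>C e n)) sums (c *\<^sub>C pert x)"
      using bounded_linear.sums[OF scaleC.bounded_linear_right[of c] pert_sums[of x]]
      by (simp add: cinner_scaleC_left scaleC_scaleC scaleC.scaleR_right)
  qed
  have "bounded_linear pert"
  proof (rule bounded_linear_intro)
    show "pert (x + y) = pert x + pert y" for x y
    proof (rule sums_unique2[OF pert_sums])
      show "(\<lambda>n. a n *\<^sub>R (cinner (x + y) (e n) *\<^sub>C e n)) sums (pert x + pert y)"
        using sums_add[OF pert_sums[of x] pert_sums[of y]]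
        by (simp add: cinner_add_left scaleC_add_left scaleR_add_right)
    qed
    show "pert (r *\<^sub>R x) = r *\<^sub>R pert x" for r x
      using scaleC[of "of_real r" x] by (simp add: scaleC_of_real)
    show "norm (pert x) \<le> norm x * (\<Sum>n. \<bar>a n\<bar>)" for x
    proof -
      have "norm (pert x) \<le> (\<Sum>n. norm (a n *\<^sub>R (cinner x (e n) *\<^sub>C e n)))"
        unfolding pert_def by (rule summable_norm[OF summable_norm_term])
      also have "\<dots> \<le> (\<Sum>n. \<bar>a n\<bar> * norm x)"
        by (rule suminf_le[OF norm_term_le summable_norm_term summable_mult2[OF a]])
      also have "\<dots> = norm x * (\<Sum>n. \<bar>a n\<bar>)"
        using suminf_mult2[OF a, of "norm x"] by (simp add: mult.commute)
      finally show ?thesis .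
    qed
  qed
  then show ?thesis
    using scaleC by (simp add: bounded_operators_def)
qed

private lemma cinner_pert_sums:
  "(\<lambda>n. of_real (a n) * (cinner x (e n) * cinner (e n) y)) sums cinner (pert x) y"
  using bounded_linear.sums[OF cinner.bounded_linear_left[of y] pert_sums[of x]]
  by (simp add: cinner.scaleR_left cinner_scaleC_left scaleR_conv_of_real)

private lemma pert_selfadjoint: "is_adjoint pert pert"
  unfolding is_adjoint_def
proof (intro allI)
  fix x y
  have "(\<lambda>n. cinner x (a n *\<^sub>R (cinner y (e n) *\<^sub>C e n)))
      = (\<lambda>n. of_real (a n) * (cinner x (e n) * cinner (e n) y))"
    by (simp add: cinner.scaleR_right cinner_scaleC_right scaleR_conv_of_real mult.commute
        flip: cinner_commute[of "e _" y])
  then have "(\<lambda>n. of_real (a n) * (cinner x (e n) * cinner (e n) y)) sums cinner x (pert y)"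
    using bounded_linear.sums[OF cinner.bounded_linear_right[of x] pert_sums[of y]] by simp
  then show "cinner (pert x) y = cinner x (pert y)"
    using cinner_pert_sums sums_unique2 by blast
qed

private lemma pert_basis: "pert (e m) = a m *\<^sub>R e m"
proof -
  have "(\<lambda>n. a n *\<^sub>R (cinner (e m) (e n) *\<^sub>C e n)) = (\<lambda>n. if n = m then a m *\<^sub>R e m else 0)"
    by (auto simp: orthonormal_seqD[OF e] scaleC_one scaleC.zero_left)
  then show ?thesis
    using pert_sums[of "e m"] sums_single[of m "\<lambda>_. a m *\<^sub>R e m"] sums_unique2 by metis
qed

private lemma cinner_pert_basis: "cinner (pert x) (e m) = of_real (a m) * cinner x (e m)"
  using is_adjointD[OF pert_selfadjoint, of x "e m"]
  by (simp add: pert_basis cinner.scaleR_right scaleR_conv_of_real)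

private lemma inner_pert_sums: "(\<lambda>n. a n * (cmod (cinner x (e n)))\<^sup>2) sums inner (pert x) x"
proof -
  have "cinner x (e n) * cinner (e n) x = of_real ((cmod (cinner x (e n)))\<^sup>2)" for n
    using cinner_commute[of "e n" x] complex_norm_square[of "cinner x (e n)"] by simp
  then have "(\<lambda>n. complex_of_real (a n * (cmod (cinner x (e n)))\<^sup>2)) sums cinner (pert x) x"
    using cinner_pert_sums[of x x] by simp
  then show ?thesis
    using sums_Re by (fastforce simp flip: Re_cinner)
qed

private lemma norm_pert_sums: "(\<lambda>n. (a n)\<^sup>2 * (cmod (cinner x (e n)))\<^sup>2) sums (norm (pert x))\<^sup>2"
proof -
  have "cinner x (e n) * cinner (e n) (pert x) = of_real (a n * (cmod (cinner x (e n)))\<^sup>2)" for n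
    using cinner_commute[of "e n" "pert x"] complex_norm_square[of "cinner x (e n)"]
    by (simp add: cinner_pert_basis mult.commute mult.left_commute)
  then have "(\<lambda>n. complex_of_real ((a n)\<^sup>2 * (cmod (cinner x (e n)))\<^sup>2)) sums cinner (pert x) (pert x)"
    using cinner_pert_sums[of x "pert x"] by (simp add: power2_eq_square mult.assoc)
  then show ?thesis
    unfolding cinner_self by (simp only: sums_of_real_iff)
qed

private lemma diag_op_pert: "diag_op e a = (\<lambda>x. x - pert x)"
  by (auto simp: diag_op_def pert_def)

lemma diag_op_bounded_operator: "diag_op e a \<in> bounded_operators"
  unfolding diag_op_pert
  by (intro bounded_operators_diff bounded_operators_ident) (simp add: pert_bounded_operator)

lemma diag_op_selfadjoint: "is_adjoint (diag_op e a) (diag_op e a)"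
  unfolding diag_op_pert is_adjoint_def
  by (simp add: cinner.diff_left cinner.diff_right is_adjointD[OF pert_selfadjoint])

lemma diag_op_basis: "diag_op e a (e m) = (1 - a m) *\<^sub>R e m"
  by (simp add: diag_op_pert pert_basis scaleR_diff_left)

lemma cinner_diag_op_basis: "cinner (diag_op e a x) (e m) = of_real (1 - a m) * cinner x (e m)"
  by (simp add: diag_op_pert cinner.diff_left cinner_pert_basis algebra_simps)

lemma diag_op_single:
  assumes "\<And>n. n \<noteq> m \<Longrightarrow> cinner x (e n) = 0"
  shows "diag_op e a x = x - a m *\<^sub>R (cinner x (e m) *\<^sub>C e m)"
proof -
  have "(\<lambda>n. a n *\<^sub>R (cinner x (e n) *\<^sub>C e n))
      = (\<lambda>n. if n = m then a m *\<^sub>R (cinner x (e m) *\<^sub>C e m) else 0)"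
    using assms by (auto simp: scaleC.zero_left)
  then have "pert x = a m *\<^sub>R (cinner x (e m) *\<^sub>C e m)"
    using pert_sums[of x] sums_single[of m "\<lambda>_. a m *\<^sub>R (cinner x (e m) *\<^sub>C e m)"] sums_unique2
    by metis
  then show ?thesis
    by (simp add: diag_op_pert)
qed

lemma inner_diag_op_sums:
  "(\<lambda>n. a n * (cmod (cinner x (e n)))\<^sup>2) sums ((norm x)\<^sup>2 - inner (diag_op e a x) x)"
  using inner_pert_sums[of x]
  by (simp add: diag_op_pert inner_diff_left power2_norm_eq_inner)

text \<open>The \<open>n\<close>-th squared coordinate shrinks by the factor \<open>(1 - a n)\<^sup>2 = 1 - (2 a n - (a n)\<^sup>2)\<close>. Stating
  the total loss of squared norm as a series shows directly when the norm is preserved.\<close>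

lemma norm_diag_op_sums:
  "(\<lambda>n. (2 * a n - (a n)\<^sup>2) * (cmod (cinner x (e n)))\<^sup>2) sums ((norm x)\<^sup>2 - (norm (diag_op e a x))\<^sup>2)"
proof -
  have "(norm x)\<^sup>2 - (norm (diag_op e a x))\<^sup>2 = 2 * inner (pert x) x - (norm (pert x))\<^sup>2"
    by (simp add: diag_op_pert power2_norm_eq_inner inner_diff_left inner_diff_right inner_commute)
  then show ?thesis
    using sums_diff[OF sums_mult[OF inner_pert_sums[of x], of 2] norm_pert_sums[of x]]
    by (simp add: left_diff_distrib mult.assoc)
qed

end

definition reflection :: "'a::complex_inner \<Rightarrow> 'a \<Rightarrow> 'a" where
  "reflection v x = x - (2 / (norm v)\<^sup>2) *\<^sub>R (cinner x v *\<^sub>C v)"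

lemma reflection_bounded_operator: "reflection v \<in> bounded_operators"
proof -
  have "bounded_linear (\<lambda>x. cinner x v *\<^sub>C v)"
    by (rule bounded_linear_compose[OF scaleC.bounded_linear_left cinner.bounded_linear_left])
  then have "(\<lambda>x. cinner x v *\<^sub>C v) \<in> bounded_operators"
    by (simp add: bounded_operators_def cinner_scaleC_left scaleC_scaleC)
  then show ?thesis
    unfolding reflection_def
    by (intro bounded_operators_diff bounded_operators_ident bounded_operators_scaleR)
qed

lemma reflection_selfadjoint: "is_adjoint (reflection v) (reflection v)"
proof -
  have "cinner (cinner x v *\<^sub>C v) y = cinner x (cinner y v *\<^sub>C v)" for x y
    using cinner_commute[of v y] by (simp add: cinner_scaleC_left cinner_scaleC_right mult.commute)
  then show ?thesis
    by (simp add: is_adjoint_def reflection_def cinner.diff_left cinner.diff_right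
        cinner.scaleR_left cinner.scaleR_right)
qed

lemma reflection_involution:
  assumes "v \<noteq> 0"
  shows "reflection v (reflection v x) = x"
proof -
  have "cinner (reflection v x) v = - cinner x v"
    using assms by (simp add: reflection_def cinner.diff_left cinner.scaleR_left cinner_scaleC_left
        cinner_self scaleR_conv_of_real)
  then show ?thesis
    by (simp add: reflection_def[of v "reflection v x"] scaleC.minus_left)
      (simp add: reflection_def)
qed

lemma reflection_orthogonal: "cinner x v = 0 \<Longrightarrow> reflection v x = x"
  by (simp add: reflection_def scaleC.zero_left)

section \<open>An operator in the class whose modulus is not\<close>

text \<open>The eigenvalues \<open>1 - eps n\<close> are \<open>2\<close> followed by \<open>1/2, 3/4, 7/8, \<dots>\<close>, which increase to \<open>1\<close>.
  They are distinct, and only the first one exceeds \<open>1\<close>.\<close>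

definition eps :: "nat \<Rightarrow> real" where
  "eps n = (if n = 0 then - 1 else (1/2) ^ n)"

lemma summable_eps: "summable (\<lambda>n. \<bar>eps n\<bar>)"
proof -
  have "(\<lambda>n. \<bar>eps n\<bar>) = (\<lambda>n. (1/2) ^ n)"
    by (auto simp: eps_def)
  then show ?thesis
    by (simp add: summable_geometric)
qed

lemma eps_pos: "n \<noteq> 0 \<Longrightarrow> 0 < eps n" "n \<noteq> 0 \<Longrightarrow> eps n \<le> 1"
  by (auto simp: eps_def power_le_one)

lemma eps_weight_pos: "n \<noteq> 0 \<Longrightarrow> 0 < 2 * eps n - (eps n)\<^sup>2"
proof -
  assume "n \<noteq> 0"
  then have "0 < eps n * (2 - eps n)"
    using eps_pos[of n] by (intro mult_pos_pos) auto
  then show ?thesis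
    by (simp add: power2_eq_square algebra_simps)
qed

lemma inj_eps: "inj eps"
proof (rule injI)
  fix m n assume *: "eps m = eps n"
  have "eps k < 0 \<longleftrightarrow> k = 0" for k
    by (simp add: eps_def)
  then have "m = 0 \<longleftrightarrow> n = 0"
    using * by metis
  then show "m = n"
    using * by (auto simp: eps_def power_one_over split: if_splits)
qed

context
  fixes e :: "nat \<Rightarrow> 'a::complex_hilbert_space"
  assumes e: "orthonormal_seq e"
begin

private abbreviation D :: "'a \<Rightarrow> 'a" where
  "D \<equiv> diag_op e eps"

private lemmas bounded_D = diag_op_bounded_operator[OF e summable_eps]
private lemmas selfadjoint_D = diag_op_selfadjoint[OF e summable_eps]
private lemmas D_basis = diag_op_basis[OF e summable_eps]
private lemmas cinner_D_basis = cinner_diag_op_basis[OF e summable_eps]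

text \<open>Only the eigenvalues with index \<open>n \<ge> 1\<close> are below \<open>1\<close>, and
  \<open>\<Sum>\<^bsub>n\<ge>1\<^esub> 2\<^sup>-\<^sup>n \<bar>\<langle>x, e n\<rangle>\<bar>\<^sup>2 \<le> \<parallel>x\<parallel>\<^sup>2\<close> because each of the inner products is at most \<open>\<parallel>x\<parallel>\<close>.\<close>

private lemma positive_D: "positive_operator D"
proof (rule positive_operatorI[OF bounded_D selfadjoint_D])
  fix x
  have "cmod (cinner x (e n)) \<le> norm x" for n
    using norm_cinner_le[of x "e n"] by (simp add: orthonormal_seq_norm[OF e])
  then have sq: "(cmod (cinner x (e n)))\<^sup>2 \<le> (norm x)\<^sup>2" for n
    by (simp add: power_mono)
  let ?f = "\<lambda>n. if n = 0 then 0 else (1/2) ^ n * (norm x)\<^sup>2"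
  have le: "eps n * (cmod (cinner x (e n)))\<^sup>2 \<le> ?f n" for n
    using mult_left_mono[OF sq[of n], of "eps n"] eps_pos(1)[of n] by (auto simp: eps_def)
  have f_sums: "?f sums (norm x)\<^sup>2"
    using sums_Suc[of ?f] sums_mult2[OF power_half_series, of "(norm x)\<^sup>2"] by simp
  have "(norm x)\<^sup>2 - inner (D x) x \<le> (norm x)\<^sup>2"
    by (rule sums_le[OF le inner_diag_op_sums[OF e summable_eps] f_sums])
  then show "0 \<le> inner (D x) x"
    by simp
qed

private lemma norm_D_le: "norm (D x) \<le> 2 * norm x"
proof -
  let ?t = "\<lambda>n. (2 * eps n - (eps n)\<^sup>2) * (cmod (cinner x (e n)))\<^sup>2"
  have "(cmod (cinner x (e 0)))\<^sup>2 \<le> (norm x)\<^sup>2"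
    using norm_cinner_le[of x "e 0"] by (simp add: orthonormal_seq_norm[OF e] power_mono)
  then have "(if n = 0 then - 3 * (norm x)\<^sup>2 else 0) \<le> ?t n" for n
    using eps_weight_pos[of n] by (auto simp: eps_def intro!: mult_nonneg_nonneg)
  then have "- 3 * (norm x)\<^sup>2 \<le> (norm x)\<^sup>2 - (norm (D x))\<^sup>2"
    using sums_le[OF _ sums_single[of 0 "\<lambda>_. - 3 * (norm x)\<^sup>2"] norm_diag_op_sums[OF e summable_eps, of x]]
    by simp
  then have "(norm (D x))\<^sup>2 \<le> (2 * norm x)\<^sup>2"
    by (simp add: power_mult_distrib)
  then show ?thesis
    by (rule power2_le_imp_le) simp
qed

text \<open>Let \<open>N\<close> be the space of vectors orthogonal to \<open>e 1, e 2, \<dots>\<close>. On the complement of \<open>N\<close> the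
  operator has norm \<open>1\<close>, as witnessed by the eigenvectors \<open>e n\<close>, but \<open>\<parallel>D x\<parallel> = \<parallel>x\<parallel>\<close> forces
  \<open>\<langle>x, e n\<rangle> = 0\<close> for every \<open>n \<ge> 1\<close>, so that \<open>x\<close> lies in \<open>N\<close> as well.\<close>

private lemma D_not_in_beta_class: "D \<notin> beta_class"
proof
  assume beta: "D \<in> beta_class"
  define N where "N = orth_complement (e ` {1..})"
  define M where "M = orth_complement N"
  have N_iff: "x \<in> N \<longleftrightarrow> (\<forall>n. n \<noteq> 0 \<longrightarrow> cinner x (e n) = 0)" for x
    by (auto simp: N_def orth_complement_def Suc_le_eq)
  have "D ` N \<subseteq> N"
    by (auto simp: N_iff cinner_D_basis)
  then have "D ` M \<subseteq> M"
    unfolding M_def by (rule is_adjoint_orth_complement[OF selfadjoint_D])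
  then have "M \<in> reducing_subspaces D"
    unfolding M_def
    by (intro selfadjoint_reducingI subspace_orth_complement closed_orth_complement selfadjoint_D)
  moreover have e_in_M: "e n \<in> M" if "n \<noteq> 0" for n
    using that cinner_commute[of "e n"] by (auto simp: M_def orth_complement_def N_iff)
  moreover have "M \<noteq> {0}"
    using e_in_M[of 1] orthonormal_seq_norm[OF e, of 1] by auto
  ultimately obtain x where x: "x \<in> M" "norm x = 1" "norm (D x) = restriction_norm D M"
    using beta by (auto simp: beta_class_def norm_attaining_on_def)
  have "1 - (1/2) ^ n \<le> norm (D x)" if "n \<ge> 1" for n
  proof -
    have "norm (D (e n)) \<le> norm (D x)"
      unfolding x(3) using that
      by (intro norm_le_restriction_norm bounded_operatorD(1)[OF bounded_D] e_in_M
          orthonormal_seq_norm[OF e]) auto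
    then show ?thesis
      using that by (simp add: D_basis orthonormal_seq_norm[OF e] eps_def power_le_one)
  qed
  moreover have "(\<lambda>n. 1 - (1/2 :: real) ^ n) \<longlonglongrightarrow> 1 - 0"
    by (intro tendsto_intros LIMSEQ_power_zero) simp
  ultimately have "1 \<le> norm (D x)"
    using LIMSEQ_le_const2[of "\<lambda>n. 1 - (1/2 :: real) ^ n" 1 "norm (D x)"] by auto
  then have "1 \<le> (norm (D x))\<^sup>2"
    by (simp add: one_le_power)
  let ?t = "\<lambda>n. (2 * eps n - (eps n)\<^sup>2) * (cmod (cinner x (e n)))\<^sup>2"
  have "e 0 \<in> N"
    by (simp add: N_iff orthonormal_seqD[OF e])
  then have "cinner x (e 0) = 0"
    using x(1) by (auto simp: M_def dest: orth_complementD)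
  then have nonneg: "0 \<le> ?t n" for n
    using eps_weight_pos[of n] by (cases "n = 0") (auto intro!: mult_nonneg_nonneg)
  have t_sums: "?t sums (1 - (norm (D x))\<^sup>2)"
    using norm_diag_op_sums[OF e summable_eps, of x] x(2) by simp
  then have "suminf ?t = 0"
    using \<open>1 \<le> (norm (D x))\<^sup>2\<close> suminf_nonneg[OF sums_summable[OF t_sums] nonneg] sums_unique[OF t_sums]
    by linarith
  then have "?t n = 0" for n
    using suminf_eq_zero_iff[OF sums_summable[OF t_sums] nonneg] by auto
  then have "x \<in> N"
    using eps_weight_pos unfolding N_iff by (metis less_irrefl mult_eq_0_iff norm_eq_zero power_eq_0_iff)
  then have "x = 0"
    using x(1) unfolding M_def by (rule in_both_orth_complement)
  then show False
    using x(2) by simp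
qed

text \<open>The eigenvalues of \<open>D\<close> are distinct and different from \<open>1\<close>, so all eigenspaces but that of
  \<open>1\<close> are lines. The components of \<open>e m\<close> in \<open>M\<close> and in its complement are orthogonal eigenvectors
  on such a line, so one of them vanishes.\<close>

private lemma basis_in_reducing_subspace:
  assumes M: "M \<in> reducing_subspaces D"
  shows "e m \<in> M \<or> e m \<in> orth_complement M"
proof -
  note M' = reducing_subspacesD[OF M]
  interpret D: bounded_linear D
    using bounded_D by (rule bounded_operatorD)
  obtain p q where p: "p \<in> M" and q: "q \<in> orth_complement M" and pq: "e m = p + q"
    using orthogonal_decomposition[OF M'(1,2)] .
  have "D p - (1 - eps m) *\<^sub>R p = - (D q - (1 - eps m) *\<^sub>R q)"
  proof -
    have "D p + D q = (1 - eps m) *\<^sub>R (p + q)"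
      using D_basis[of m] by (simp add: pq D.add)
    then show ?thesis
      by (simp add: algebra_simps)
  qed
  moreover have "D p - (1 - eps m) *\<^sub>R p \<in> M"
    using M' p by (intro complex_vector.subspace_diff complex_subspace_scaleR) auto
  moreover have "- (D q - (1 - eps m) *\<^sub>R q) \<in> orth_complement M"
    using M'(4) q subspace_orth_complement[of M]
    by (intro complex_vector.subspace_neg complex_vector.subspace_diff complex_subspace_scaleR) auto
  ultimately have Dp: "D p = (1 - eps m) *\<^sub>R p"
    using in_both_orth_complement by fastforce
  have "cinner p (e n) = 0" if "n \<noteq> m" for n
  proof -
    have "complex_of_real (1 - eps m) * cinner p (e n) = of_real (1 - eps n) * cinner p (e n)"
      using cinner_D_basis[of p n] unfolding Dp cinner.scaleR_left scaleR_conv_of_real .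
    then have "cinner p (e n) = 0 \<or> 1 - eps m = 1 - eps n"
      by (simp only: mult_cancel_right of_real_eq_iff)
    moreover have "eps m \<noteq> eps n"
      using that inj_eps by (auto dest: injD)
    ultimately show ?thesis
      by simp
  qed
  then have "D p = p - eps m *\<^sub>R (cinner p (e m) *\<^sub>C e m)"
    by (rule diag_op_single[OF e summable_eps])
  then have "eps m *\<^sub>R p = eps m *\<^sub>R (cinner p (e m) *\<^sub>C e m)"
    using Dp by (auto simp: algebra_simps)
  moreover have "eps m \<noteq> 0"
    by (simp add: eps_def)
  ultimately have p_eq: "p = cinner p (e m) *\<^sub>C e m"
    by (metis scaleR_cancel_left)
  show ?thesis
  proof (cases "cinner p (e m) = 0")
    case True
    then have "p = 0"
      using p_eq by (simp add: scaleC.zero_left)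
    then show ?thesis
      using pq q by simp
  next
    case False
    have "(1 / cinner p (e m)) *\<^sub>C p = (1 / cinner p (e m)) *\<^sub>C (cinner p (e m) *\<^sub>C e m)"
      using p_eq by (rule arg_cong)
    also have "\<dots> = e m"
      using False by (simp add: scaleC_scaleC scaleC_one)
    finally show ?thesis
      using complex_vector.subspace_scale[OF M'(1) p] by metis
  qed
qed

text \<open>A vector that is orthogonal to no \<open>e n\<close>.\<close>

private definition v :: 'a where
  "v = (\<Sum>n. (1/2) ^ n *\<^sub>R e n)"

private lemma cinner_v_basis: "cinner v (e m) = (1/2) ^ m"
proof -
  have "summable (\<lambda>n. norm ((1/2 :: real) ^ n *\<^sub>R e n))"
    by (simp add: orthonormal_seq_norm[OF e] summable_geometric)
  then have "(\<lambda>n. (1/2 :: real) ^ n *\<^sub>R e n) sums v"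
    unfolding v_def by (rule summable_sums[OF summable_norm_cancel])
  then have "(\<lambda>n. cinner ((1/2 :: real) ^ n *\<^sub>R e n) (e m)) sums cinner v (e m)"
    by (rule bounded_linear.sums[OF cinner.bounded_linear_left])
  moreover have "(\<lambda>n. cinner ((1/2 :: real) ^ n *\<^sub>R e n) (e m)) = (\<lambda>n. if n = m then (1/2) ^ m else 0)"
    by (auto simp: cinner.scaleR_left orthonormal_seqD[OF e] scaleR_conv_of_real)
  ultimately show ?thesis
    using sums_single[of m "\<lambda>_. (1/2 :: complex) ^ m"] sums_unique2 by metis
qed

private lemma v_nonzero: "v \<noteq> 0"
  using cinner_v_basis[of 0] by (auto simp: cinner.zero_left)

private definition T :: "'a \<Rightarrow> 'a" where
  "T = reflection v \<circ> D"

private lemma bounded_T: "T \<in> bounded_operators"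
  unfolding T_def by (intro bounded_operators_comp reflection_bounded_operator bounded_D)

private lemma abs_T: "abs_operator T = D"
proof (rule abs_operator_eqI[OF bounded_T _ positive_D])
  show "is_adjoint T (D \<circ> reflection v)"
    by (simp add: is_adjoint_def T_def is_adjointD[OF selfadjoint_D]
        is_adjointD[OF reflection_selfadjoint])
  show "D \<circ> D = (D \<circ> reflection v) \<circ> T"
    by (auto simp: T_def reflection_involution[OF v_nonzero])
qed

text \<open>A reducing subspace \<open>M\<close> that contains \<open>e 0\<close> attains the norm \<open>2\<close> there. Otherwise \<open>e 0\<close> lies
  in the complement of \<open>M\<close>, and so does \<open>T (e 0)\<close>, which is a combination of \<open>e 0\<close> and \<open>v\<close> with
  nonzero coefficient at \<open>v\<close>. No \<open>e n\<close> is orthogonal to \<open>v\<close>, hence no \<open>e n\<close> lies in \<open>M\<close>; then all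
  of them lie in the complement and \<open>T\<close> is the identity on \<open>M\<close>.\<close>

private lemma T_in_beta_class: "T \<in> beta_class"
proof -
  have norm_T: "norm (T x) = norm (D x)" for x
    using norm_abs_operator[OF bounded_T, of x] by (simp add: abs_T)
  have "norm_attaining_on T M" if M: "M \<in> reducing_subspaces T" and "M \<noteq> {0}" for M
  proof -
    note M' = reducing_subspacesD[OF M]
    have in_or_orth: "e n \<in> M \<or> e n \<in> orth_complement M" for n
      using basis_in_reducing_subspace reducing_abs_operator[OF bounded_T M] by (simp add: abs_T)
    show ?thesis
    proof (cases "e 0 \<in> M")
      case True
      have "norm (T (e 0)) = 2"
        by (simp add: norm_T D_basis orthonormal_seq_norm[OF e] eps_def)
      then show ?thesis
        using True norm_D_le
        by (intro norm_attaining_onI[of T "e 0"] bounded_operatorD(1)[OF bounded_T]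
            orthonormal_seq_norm[OF e]) (metis mult.right_neutral norm_T)+
    next
      case False
      define M2 where "M2 = orth_complement M"
      have sub: "complex_vector.subspace M2"
        unfolding M2_def by (rule subspace_orth_complement)
      have e0: "e 0 \<in> M2"
        using False in_or_orth by (auto simp: M2_def)
      have "T (e 0) = 2 *\<^sub>R e 0 - (4 / (norm v)\<^sup>2) *\<^sub>R v"
      proof -
        have "cinner (2 *\<^sub>R e 0) v = 2"
          using cinner_v_basis[of 0] cinner_commute[of "e 0" v]
          by (simp add: cinner.scaleR_left scaleR_conv_of_real)
        moreover have "(2::complex) *\<^sub>C v = 2 *\<^sub>R v"
          using scaleC_of_real[of 2 v] by simp
        ultimately show ?thesis
          by (simp add: T_def D_basis eps_def reflection_def)
      qed
      then have "v = ((norm v)\<^sup>2 / 4) *\<^sub>R (2 *\<^sub>R e 0 - T (e 0))"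
        using v_nonzero by simp
      moreover have "2 *\<^sub>R e 0 - T (e 0) \<in> M2"
        using M'(4) e0
        by (intro complex_vector.subspace_diff[OF sub] complex_subspace_scaleR[OF sub])
          (auto simp: M2_def)
      ultimately have v: "v \<in> M2"
        using complex_subspace_scaleR[OF sub] by metis
      have "e n \<in> M2" for n
      proof -
        have "e n \<notin> M"
          using v cinner_v_basis[of n] unfolding M2_def by (auto dest: orth_complementD)
        then show ?thesis
          using in_or_orth by (auto simp: M2_def)
      qed
      then have T_id: "T x = x" if "x \<in> M" for x
      proof -
        have orth: "cinner x w = 0" if "w \<in> M2" for w
          using orth_complementD(2)[of w M x] that \<open>x \<in> M\<close> by (simp add: M2_def)
        then have "D x = x"
          using diag_op_single[OF e summable_eps, of 0 x] \<open>\<And>n. e n \<in> M2\<close>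
          by (simp add: scaleC.zero_left)
        then show ?thesis
          using orth[OF v] by (simp add: T_def reflection_orthogonal)
      qed
      obtain y where y: "y \<in> M" "y \<noteq> 0"
        using \<open>M \<noteq> {0}\<close> complex_vector.subspace_0[OF M'(1)] by blast
      define u where "u = (1 / norm y) *\<^sub>R y"
      have "u \<in> M" "norm u = 1"
        using y complex_subspace_scaleR[OF M'(1)] by (simp_all add: u_def)
      then show ?thesis
        by (intro norm_attaining_onI[of T u] bounded_operatorD(1)[OF bounded_T]) (simp_all add: T_id)
    qed
  qed
  then show ?thesis
    using bounded_T by (simp add: beta_class_def)
qed

lemma beta_class_abs_operator_counterexample:
  "\<exists>T \<in> (bounded_operators :: ('a \<Rightarrow> 'a) set). T \<in> beta_class \<and> abs_operator T \<notin> beta_class"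
  using bounded_T T_in_beta_class D_not_in_beta_class abs_T by metis

end

theorem proposition2p6:
  assumes "infinite_dimensional TYPE('a::complex_hilbert_space)"
    and "separable_space (euclidean :: 'a topology)"
  shows "(\<forall>T \<in> (bounded_operators :: ('a \<Rightarrow> 'a) set). abs_operator T \<in> beta_class \<longrightarrow> T \<in> beta_class)
    \<and> (\<exists>T \<in> (bounded_operators :: ('a \<Rightarrow> 'a) set). T \<in> beta_class \<and> abs_operator T \<notin> beta_class)"
proof
  show "\<forall>T \<in> (bounded_operators :: ('a \<Rightarrow> 'a) set). abs_operator T \<in> beta_class \<longrightarrow> T \<in> beta_class"
    using beta_class_if_abs_operator by blast
  obtain e :: "nat \<Rightarrow> 'a" where "orthonormal_seq e"
    using orthonormal_seq_exists[OF assms(1)] .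
  then show "\<exists>T \<in> (bounded_operators :: ('a \<Rightarrow> 'a) set). T \<in> beta_class \<and> abs_operator T \<notin> beta_class"
    by (rule beta_class_abs_operator_counterexample)
qed

end
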